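(* There are positive constants $d_{3\text{-par.}}$ and $\varepsilon_{3\text{-par.}}$ such that, in the bounded degree model with degree bound $d_{3\text{-par.}}$ and proximity parameter $\varepsilon_{3\text{-par.}}$, the query complexity of testing $3$-partiteness of $3$-uniform $n$-vertex hypergraphs is $\Omega(n)$.
   Context: A hypergraph is $3$-uniform if every hyperedge has exactly $3$ vertices; it is $3$-partite if there is a map $V(H)\to\{1,2,3\}$ giving the three vertices of every hyperedge three distinct colors. Bounded degree model: a hypergraph of maximum degree at most $\Delta$ is accessed via queries to lists $A_1,\dots,A_n$ of length $\Delta$, $A_i$ listing the hyperedges incident to vertex $i$ padded with $\bot$. Distance between $H_1=([n],E_1)$, $H_2=([n],E_2)$ is $(|E_1\setminus E_2|+|E_2\setminus E_1|)/(\Delta n)$; $H$ is $\varepsilon$-far from a property if its distance to every $3$-uniform $n$-vertex hypergraph with the property exceeds $\varepsilon$. An $\varepsilon$-tester accepts with probability $\ge 2/3$ inputs having the property and with probability $\le 1/3$ inputs $\varepsilon$-far from it; "query complexity $\Omega(n)$" means every such tester makes $\Omega(n)$ queries in the worst case. *)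

theory Defs
  imports "HOL-Probability.Probability_Mass_Function" "HOL-Library.Landau_Symbols"
begin

text \<open>
  A hypergraph on \<open>n\<close> vertices has vertex set \<open>{..<n}\<close> (instead of \<open>{1..n}\<close>) and is
  given by its set of hyperedges.
\<close>

type_synonym hypergraph = "nat set set"

definition uniform_hypergraph :: "nat \<Rightarrow> nat \<Rightarrow> hypergraph \<Rightarrow> bool" where
  "uniform_hypergraph k n E \<longleftrightarrow> (\<forall>e\<in>E. e \<subseteq> {..<n} \<and> card e = k)"

definition vertex_degree :: "hypergraph \<Rightarrow> nat \<Rightarrow> nat" where
  "vertex_degree E v = card {e \<in> E. v \<in> e}"

definition bounded_3_uniform :: "nat \<Rightarrow> nat \<Rightarrow> hypergraph \<Rightarrow> bool" where
  "bounded_3_uniform d n E \<longleftrightarrow> uniform_hypergraph 3 n E \<and> (\<forall>v<n. vertex_degree E v \<le> d)"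

definition three_partite :: "nat \<Rightarrow> hypergraph \<Rightarrow> bool" where
  "three_partite n E \<longleftrightarrow>
     (\<exists>c :: nat \<Rightarrow> nat. c ` {..<n} \<subseteq> {1, 2, 3} \<and> (\<forall>e\<in>E. inj_on c e))"

definition hypergraph_dist :: "nat \<Rightarrow> nat \<Rightarrow> hypergraph \<Rightarrow> hypergraph \<Rightarrow> real" where
  "hypergraph_dist d n E\<^sub>1 E\<^sub>2 =
     real (card (E\<^sub>1 - E\<^sub>2) + card (E\<^sub>2 - E\<^sub>1)) / (real d * real n)"

text \<open>The comparison hypergraphs \<open>E'\<close> are not required to satisfy the degree bound.\<close>

definition far_from ::
  "(nat \<Rightarrow> hypergraph \<Rightarrow> bool) \<Rightarrow> nat \<Rightarrow> real \<Rightarrow> nat \<Rightarrow> hypergraph \<Rightarrow> bool" where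
  "far_from P d \<epsilon> n E \<longleftrightarrow>
     (\<forall>E'. uniform_hypergraph 3 n E' \<and> P n E' \<longrightarrow> hypergraph_dist d n E E' > \<epsilon>)"

text \<open>
  The input is the table of incidence lists, with \<open>None\<close> in the role of \<open>\<bottom>\<close>. The order
  of the hyperedges within each list is arbitrary, so a hypergraph has several tables.
\<close>

type_synonym table = "nat set option list list"

definition represents :: "nat \<Rightarrow> nat \<Rightarrow> table \<Rightarrow> hypergraph \<Rightarrow> bool" where
  "represents d n A E \<longleftrightarrow> length A = n \<and>
     (\<forall>v<n. \<exists>es. distinct es \<and> set es = {e \<in> E. v \<in> e} \<and> length es \<le> d \<and>
        A ! v = map Some es @ replicate (d - length es) None)"

definition answer :: "table \<Rightarrow> nat \<Rightarrow> nat \<Rightarrow> nat set option" where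
  "answer A v j = (if v < length A \<and> j < length (A ! v) then A ! v ! j else None)"

text \<open>
  A deterministic adaptive algorithm is a decision tree; \<open>Query v j k\<close> asks for the
  \<open>j\<close>-th entry of the list of \<open>v\<close> and continues with \<open>k\<close> applied to the answer. A
  randomized algorithm is a probability distribution on decision trees. It may depend
  on \<open>n\<close> in any way, and only queries are charged.
\<close>

datatype decision_tree =
    Decide bool
  | Query nat nat "nat set option \<Rightarrow> decision_tree"

primrec accepts :: "decision_tree \<Rightarrow> table \<Rightarrow> bool" where
  "accepts (Decide b) A = b"
| "accepts (Query v j k) A = accepts (k (answer A v j)) A"

primrec num_queries :: "decision_tree \<Rightarrow> table \<Rightarrow> nat" where
  "num_queries (Decide b) A = 0"
| "num_queries (Query v j k) A = Suc (num_queries (k (answer A v j)) A)"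

definition accept_prob :: "decision_tree pmf \<Rightarrow> table \<Rightarrow> real" where
  "accept_prob \<T> A = measure_pmf.prob \<T> {T. accepts T A}"

definition is_tester ::
  "(nat \<Rightarrow> hypergraph \<Rightarrow> bool) \<Rightarrow> nat \<Rightarrow> real \<Rightarrow> nat \<Rightarrow> decision_tree pmf \<Rightarrow> bool" where
  "is_tester P d \<epsilon> n \<T> \<longleftrightarrow>
     (\<forall>E A. bounded_3_uniform d n E \<and> represents d n A E \<longrightarrow>
        (P n E \<longrightarrow> accept_prob \<T> A \<ge> 2 / 3) \<and>
        (far_from P d \<epsilon> n E \<longrightarrow> accept_prob \<T> A \<le> 1 / 3))"

definition queries_at_most :: "nat \<Rightarrow> nat \<Rightarrow> decision_tree pmf \<Rightarrow> nat \<Rightarrow> bool" where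
  "queries_at_most d n \<T> q \<longleftrightarrow>
     (\<forall>T \<in> set_pmf \<T>. \<forall>E A. bounded_3_uniform d n E \<and> represents d n A E \<longrightarrow>
        num_queries T A \<le> q)"

text \<open>
  The least worst-case number of queries of a tester. For \<open>\<epsilon> \<ge> 0\<close> the infimum is over a
  nonempty set, see \<open>tester_exists\<close> below.
\<close>

definition query_complexity ::
  "(nat \<Rightarrow> hypergraph \<Rightarrow> bool) \<Rightarrow> nat \<Rightarrow> real \<Rightarrow> nat \<Rightarrow> nat" where
  "query_complexity P d \<epsilon> n =
     Inf {q. \<exists>\<T>. is_tester P d \<epsilon> n \<T> \<and> queries_at_most d n \<T> q}"

lemma read_entries:
  "\<exists>T. \<forall>A. accepts T A = f (map (\<lambda>(v, j). answer A v j) ps) \<and> num_queries T A = length ps"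
proof (induction ps arbitrary: f)
  case Nil
  show ?case by (rule exI[of _ "Decide (f [])"]) simp
next
  case (Cons p ps)
  have "\<forall>a. \<exists>T. \<forall>A. accepts T A = f (a # map (\<lambda>(v, j). answer A v j) ps)
          \<and> num_queries T A = length ps"
    using Cons.IH[of "\<lambda>as. f (_ # as)"] by blast
  then obtain k where
    "\<And>a A. accepts (k a) A = f (a # map (\<lambda>(v, j). answer A v j) ps)
       \<and> num_queries (k a) A = length ps"
    by metis
  then show ?case
    by (intro exI[of _ "Query (fst p) (snd p) k"]) (cases p, simp)
qed

lemma edges_from_table:
  assumes "uniform_hypergraph 3 n E" "represents d n A E"
  shows "{e. Some e \<in> set (map (\<lambda>(v, j). answer A v j) (List.product [0..<n] [0..<d]))} = E"
proof (intro set_eqI iffI)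
  fix e
  assume "e \<in> {e. Some e \<in> set (map (\<lambda>(v, j). answer A v j) (List.product [0..<n] [0..<d]))}"
  then obtain v j where vj: "v < n" "j < d" "answer A v j = Some e"
    by force
  then obtain es where es: "set es = {e \<in> E. v \<in> e}" "length es \<le> d"
    "A ! v = map Some es @ replicate (d - length es) None"
    using assms(2) unfolding represents_def by blast
  have "Some e \<in> set (A ! v)"
    using vj(3) unfolding answer_def by (auto split: if_splits simp: in_set_conv_nth)
  then show "e \<in> E" using es by auto
next
  fix e assume e: "e \<in> E"
  then have "e \<subseteq> {..<n}" "e \<noteq> {}" using assms(1) unfolding uniform_hypergraph_def by fastforce+
  then obtain v where v: "v \<in> e" "v < n" by blast
  then obtain es where es: "set es = {e \<in> E. v \<in> e}" "length es \<le> d"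
    "A ! v = map Some es @ replicate (d - length es) None"
    using assms(2) unfolding represents_def by blast
  then obtain j where j: "j < length es" "es ! j = e"
    using e v by (metis (mono_tags, lifting) in_set_conv_nth mem_Collect_eq)
  have "answer A v j = Some e"
    using j es v assms(2) by (simp add: answer_def represents_def nth_append)
  then show "e \<in> {e. Some e \<in> set (map (\<lambda>(v, j). answer A v j) (List.product [0..<n] [0..<d]))}"
    using v j es(2) by (auto intro!: image_eqI[of _ _ "(v, j)"])
qed

lemma tester_exists:
  assumes "\<epsilon> \<ge> 0"
  shows "\<exists>\<T>. is_tester P d \<epsilon> n \<T> \<and> queries_at_most d n \<T> (n * d)"
proof -
  let ?ps = "List.product [0..<n] [0..<d]"
  obtain T where T: "\<And>A. accepts T A = P n {e. Some e \<in> set (map (\<lambda>(v, j). answer A v j) ?ps)}"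
    "\<And>A. num_queries T A = length ?ps"
    using read_entries[of "\<lambda>as. P n {e. Some e \<in> set as}" ?ps] by blast
  have not_far: "\<not> far_from P d \<epsilon> n E" if "uniform_hypergraph 3 n E" "P n E" for E
    using that assms unfolding far_from_def hypergraph_dist_def
    by (metis Diff_cancel add.right_neutral card.empty div_0 linorder_not_less of_nat_0)
  have "accepts T A = P n E" if "uniform_hypergraph 3 n E" "represents d n A E" for A E
    using T(1) edges_from_table[OF that] by simp
  then have "is_tester P d \<epsilon> n (return_pmf T)"
    using not_far
    by (auto simp: is_tester_def bounded_3_uniform_def accept_prob_def measure_return_pmf
          indicator_def)
  moreover have "queries_at_most d n (return_pmf T) (n * d)"
    using T(2) by (simp add: queries_at_most_def)
  ultimately show ?thesis by blast
qed

end

theory Submission imports Defs begin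

text \<open>
  Take \<open>4 * N\<close> equations over the field with two elements, each the sum of four of \<open>2 * N\<close>
  variables, such that any \<open>N div 1728\<close> left-hand sides are linearly independent although
  every variable occurs at most 16 times; an expander argument provides them. Against few
  queries, the right-hand sides of a random satisfiable system look like independent bits, and so
  do their translates by a fixed vector that is at distance more than \<open>N / 3\<close> from all
  satisfiable right-hand sides. A variable becomes a hyperedge whose three vertices get three
  distinct colours, and its value is the sign of this permutation of the colours; renaming the
  colours flips all four signs in an equation or none, so no global palette is needed. Each equation becomes a gadget of bounded size on
  its four hyperedges. Its right-hand side only affects the incidence lists of vertices
  private to the gadget, so one query reveals at most one bit, and unsatisfied
  equations are gadgets in which a hyperedge has to be removed.
\<close>

section \<open>Sparse independent systems\<close>

text \<open>The four occurrences of variables in equation \<open>i\<close> are the slots \<open>4 * i\<close> to \<open>4 * i + 3\<close>.\<close>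

definition slots :: "nat set \<Rightarrow> nat set" where
  "slots S = {x. x div 4 \<in> S}"

lemma slots_conv_UN: "slots S = (\<Union>i\<in>S. {4 * i..<4 * i + 4})"
proof -
  have "x \<in> {4 * (x div 4)..<4 * (x div 4) + 4}" for x :: nat
    by simp
  moreover have "x div 4 = i" if "x \<in> {4 * i..<4 * i + 4}" for x i :: nat
    using that by auto
  ultimately show ?thesis unfolding slots_def by blast
qed

lemma finite_slots: "finite S \<Longrightarrow> finite (slots S)"
  by (simp add: slots_conv_UN)

lemma card_slots: "finite S \<Longrightarrow> card (slots S) = 4 * card S"
  unfolding slots_conv_UN by (subst card_UN_disjoint) auto

lemma slots_subset: "S \<subseteq> {..<4 * N} \<Longrightarrow> slots S \<subseteq> {..<16 * N}"
  unfolding slots_conv_UN by fastforce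

section \<open>Binomial estimates for the union bound\<close>

lemma self_power_le_fact: "k ^ k \<le> 3 ^ k * fact k"
proof -
  \<comment> \<open>The left side is one term of the exponential series at \<open>k\<close>, and
    \<open>exp 1\<close> is at most 3.\<close>
  have "real k ^ k / fact k \<le> (\<Sum>i. real k ^ i / fact i)"
    using sum_le_suminf[OF summable_exp_generic[of "real k"], of "{k}"]
    by (simp add: divide_inverse mult.commute)
  also have "\<dots> = exp (real k)"
    by (simp add: exp_def divide_inverse mult.commute)
  also have "\<dots> = exp 1 ^ k"
    by (simp add: exp_of_nat_mult[symmetric])
  also have "\<dots> \<le> 3 ^ k"
    by (intro power_mono exp_le) simp
  finally have "real (k ^ k) \<le> real (3 ^ k * fact k)"
    by (simp add: divide_simps)
  then show ?thesis by (simp only: of_nat_le_iff)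
qed

text \<open>A division-free form of the bound \<open>(e * n / k) ^ k\<close> for
  \<open>n choose k\<close>, with 3 in place of e.\<close>

lemma binomial_mult_self_power_le: "(n choose k) * k ^ k \<le> (3 * n) ^ k"
proof -
  have "(n choose k) * k ^ k \<le> 3 ^ k * ((n choose k) * fact k)"
    using mult_le_mono2[OF self_power_le_fact, of "n choose k" k] by (simp add: mult_ac)
  also have "\<dots> \<le> 3 ^ k * n ^ k"
    by (intro mult_le_mono2 binomial_fact_pow)
  finally show ?thesis by (simp add: power_mult_distrib)
qed

text \<open>A random map sends the slots of \<open>s\<close> given equations into
  \<open>2 * s\<close> given values with probability \<open>(2 * s / N) ^ (4 * s)\<close>. Summed
  over all choices, this is at most \<open>1 / 4 ^ s\<close>; the constant is 1728 = 4 * 12 * 9 *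
  4.\<close>

lemma union_bound_term:
  assumes "1 \<le> s" "1728 * s \<le> N"
  shows "4 ^ s * ((4 * N choose s) * (N choose (2 * s)) * (2 * s) ^ (4 * s)) \<le> N ^ (4 * s)"
proof -
  let ?A = "4 * N choose s" and ?B = "N choose (2 * s)"
  have "s ^ s * (4 ^ s * (?A * ?B * (2 * s) ^ (4 * s)))
      = 4 ^ s * (?A * s ^ s) * (?B * (2 * s) ^ (2 * s)) * (2 * s) ^ (2 * s)"
    by (simp add: power_add[symmetric] mult_ac flip: mult_2)
  also have "\<dots> \<le> 4 ^ s * (3 * (4 * N)) ^ s * (3 * N) ^ (2 * s) * (2 * s) ^ (2 * s)"
    by (intro mult_le_mono le_refl binomial_mult_self_power_le)
  also have "\<dots> = (4 * (3 * (4 * N)) * (3 * N)\<^sup>2 * (2 * s)\<^sup>2) ^ s"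
    by (simp only: power_mult_distrib power_mult)
  also have "4 * (3 * (4 * N)) * (3 * N)\<^sup>2 * (2 * s)\<^sup>2 = s * ((1728 * s) * N ^ 3)"
    by (simp add: power2_eq_square power3_eq_cube)
  also have "(s * ((1728 * s) * N ^ 3)) ^ s \<le> (s * (N * N ^ 3)) ^ s"
    using assms by (intro power_mono mult_le_mono) auto
  also have "\<dots> = s ^ s * N ^ (4 * s)"
    by (simp add: power_mult_distrib power_mult flip: power_Suc)
  finally show ?thesis using assms by simp
qed

text \<open>
  Union bound over the sets \<open>S\<close> of at most \<open>N div 1728\<close> equations and over the sets of
  \<open>2 * card S\<close> variables that could contain the image of the slots of \<open>S\<close>.
\<close>

lemma ex_expanding_map:
  assumes N: "N > 0"
  shows "\<exists>f :: nat \<Rightarrow> nat. (\<forall>x<16 * N. f x < N) \<and>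
    (\<forall>S \<subseteq> {..<4 * N}. S \<noteq> {} \<longrightarrow> card S \<le> N div 1728 \<longrightarrow> 2 * card S < card (f ` slots S))"
proof -
  define F where "F = PiE {..<16 * N} (\<lambda>_. {..<N})"
  define G where "G S W = PiE {..<16 * N} (\<lambda>x. if x \<in> slots S then W else {..<N})"
    for S and W :: "nat set"
  define SS where "SS s = {S. S \<subseteq> {..<4 * N} \<and> card S = s}" for s
  define WW where "WW s = {W. W \<subseteq> {..<N} \<and> card W = 2 * s}" for s
  define Bad where "Bad s = (\<Union>S\<in>SS s. \<Union>W\<in>WW s. G S W)" for s
  let ?K = "N div 1728"
  have cardF: "card F = N ^ (16 * N)"
    unfolding F_def by (simp add: card_PiE)
  have cardG: "card (G S W) = (2 * s) ^ (4 * s) * N ^ (16 * N - 4 * s)"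
    if "S \<in> SS s" "W \<in> WW s" for S W s
  proof -
    have S: "S \<subseteq> {..<4 * N}" "card S = s" and W: "card W = 2 * s"
      using that by (auto simp: SS_def WW_def)
    have finS: "finite S" using S(1) finite_subset by blast
    have "card (G S W) = (\<Prod>x\<in>{..<16 * N}. if x \<in> slots S then 2 * s else N)"
      unfolding G_def by (subst card_PiE) (auto simp: W intro!: prod.cong)
    also have "\<dots> = (2 * s) ^ card (slots S) * N ^ card ({..<16 * N} - slots S)"
      using slots_subset[OF S(1)]
      by (simp add: prod.If_cases Int_absorb1 Diff_eq)
    also have "\<dots> = (2 * s) ^ (4 * s) * N ^ (16 * N - 4 * s)"
      using slots_subset[OF S(1)] finite_slots[OF finS] S(2)
      by (simp add: card_slots[OF finS] card_Diff_subset)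
    finally show ?thesis .
  qed
  have fin: "finite (SS s)" "finite (WW s)" for s
    by (auto simp: SS_def WW_def)
  have cards: "card (SS s) = 4 * N choose s" "card (WW s) = N choose (2 * s)" for s
    unfolding SS_def WW_def by (simp_all add: n_subsets)
  have Bad_le: "4 ^ s * card (Bad s) \<le> N ^ (16 * N)" if s: "s \<in> {1..?K}" for s
  proof -
    have "card (Bad s) \<le> (\<Sum>S\<in>SS s. \<Sum>W\<in>WW s. card (G S W))"
      unfolding Bad_def by (intro order.trans[OF card_UN_le] sum_mono card_UN_le fin)
    also have "\<dots> = (\<Sum>S\<in>SS s. \<Sum>W\<in>WW s. (2 * s) ^ (4 * s) * N ^ (16 * N - 4 * s))"
      by (intro sum.cong refl cardG)
    also have "\<dots> = ((4 * N choose s) * (N choose (2 * s)) * (2 * s) ^ (4 * s)) * N ^ (16 * N - 4 * s)"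
      by (simp add: cards)
    finally have "4 ^ s * card (Bad s)
      \<le> 4 ^ s * ((4 * N choose s) * (N choose (2 * s)) * (2 * s) ^ (4 * s)) * N ^ (16 * N - 4 * s)"
      by (simp add: mult.assoc)
    also have "\<dots> \<le> N ^ (4 * s) * N ^ (16 * N - 4 * s)"
      using s by (intro mult_le_mono1 union_bound_term) auto
    also have "\<dots> = N ^ (16 * N)"
    proof -
      have "4 * s \<le> 16 * N"
        using s div_le_dividend[of N 1728] by (simp only: atLeastAtMost_iff) linarith
      then show ?thesis by (simp flip: power_add)
    qed
    finally show ?thesis .
  qed
  \<comment> \<open>Over all \<open>s\<close>, the bad events have total probability below 1/3, so
    some map avoids them.\<close>
  have geometric: "(\<Sum>s=1..k. (1 / 4 :: real) ^ s) = (1 - (1 / 4) ^ k) / 3" for k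
  proof (induction k)
    case (Suc k)
    have "(\<Sum>s=1..Suc k. (1 / 4 :: real) ^ s) = (1 - (1 / 4) ^ k) / 3 + 1 / 4 * (1 / 4) ^ k"
      using Suc by simp
    then show ?case unfolding power_Suc by argo
  qed simp
  have "real (card (\<Union>s\<in>{1..?K}. Bad s)) \<le> (\<Sum>s=1..?K. real (card (Bad s)))"
    using card_UN_le[of "{1..?K}" Bad] by (simp flip: of_nat_sum)
  also have "\<dots> \<le> (\<Sum>s=1..?K. real (N ^ (16 * N)) * (1 / 4) ^ s)"
  proof (intro sum_mono)
    fix s assume "s \<in> {1..?K}"
    then have "real (4 ^ s * card (Bad s)) \<le> real (N ^ (16 * N))"
      using Bad_le by (simp only: of_nat_le_iff)
    then show "real (card (Bad s)) \<le> real (N ^ (16 * N)) * (1 / 4) ^ s"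
      by (simp add: field_simps)
  qed
  also have "\<dots> = real (N ^ (16 * N)) * (\<Sum>s=1..?K. (1 / 4) ^ s)"
    by (simp only: sum_distrib_left)
  also have "(\<Sum>s=1..?K. (1 / 4 :: real) ^ s) = (1 - (1 / 4) ^ ?K) / 3"
    by (rule geometric)
  also have "real (N ^ (16 * N)) * ((1 - (1 / 4) ^ ?K) / 3) < real (N ^ (16 * N)) * 1"
    using N by (intro mult_strict_left_mono) (simp_all add: field_simps add_pos_nonneg)
  finally have "card (\<Union>s\<in>{1..?K}. Bad s) < card F"
    by (simp add: cardF)
  moreover have "finite (\<Union>s\<in>{1..?K}. Bad s)"
    unfolding Bad_def G_def
    by (intro finite_UN_I fin finite_PiE) (auto simp: WW_def intro: finite_subset)
  ultimately have "\<not> F \<subseteq> (\<Union>s\<in>{1..?K}. Bad s)"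
    using card_mono linorder_not_le by blast
  then obtain f where f: "f \<in> F" "f \<notin> (\<Union>s\<in>{1..?K}. Bad s)"
    by blast
  have "2 * card S < card (f ` slots S)"
    if S: "S \<subseteq> {..<4 * N}" "S \<noteq> {}" "card S \<le> ?K" for S
  proof (rule ccontr)
    assume less: "\<not> 2 * card S < card (f ` slots S)"
    have finS: "finite S" using S(1) finite_subset by blast
    have im: "f ` slots S \<subseteq> {..<N}"
      using slots_subset[OF S(1)] f(1) by (auto simp: F_def)
    have "2 * card S \<le> card {..<N}" using S(3) by simp
    \<comment> \<open>The image is enlarged to size exactly \<open>2 * card S\<close>, as
      \<open>WW\<close> requires.\<close>
    then obtain W where W: "f ` slots S \<subseteq> W" "W \<subseteq> {..<N}" "card W = 2 * card S"
      using exists_subset_between[of "f ` slots S" "2 * card S" "{..<N}"] less im by auto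
    have "f \<in> G S W"
      using f(1) W(1) unfolding F_def G_def by (auto simp: PiE_iff)
    moreover have "card S \<in> {1..?K}" using S finS by (auto simp: Suc_le_eq card_gt_0_iff)
    ultimately show False using f(2) S W unfolding Bad_def SS_def WW_def by blast
  qed
  moreover have "\<forall>x<16 * N. f x < N" using f(1) by (auto simp: F_def)
  ultimately show ?thesis by blast
qed

text \<open>
  A variable with many occurrences is replaced by several copies. Numbering the slots by
  their rank \<open>p\<close> in the lexicographic order of the pairs \<open>(f x, x)\<close>, the map
  \<open>x \<mapsto> f x + p x div 16\<close> refines \<open>f\<close> and is at most 16 to 1.
\<close>

lemma ex_bounded_refinement:
  fixes f :: "nat \<Rightarrow> nat"
  assumes f: "\<And>x. x < 16 * N \<Longrightarrow> f x < N"
  shows "\<exists>h. (\<forall>x<16 * N. h x < 2 * N) \<and> (\<forall>y. card {x. x < 16 * N \<and> h x = y} \<le> 16) \<and>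
    (\<forall>x<16 * N. \<forall>x'<16 * N. h x = h x' \<longrightarrow> f x = f x')"
proof -
  define B where "B x = {x'. x' < 16 * N \<and> (f x' < f x \<or> f x' = f x \<and> x' < x)}" for x
  define p where "p x = card (B x)" for x
  define h where "h x = f x + p x div 16" for x
  have finB: "finite (B x)" for x unfolding B_def by auto
  have p_mono: "p x < p x'" if "x < 16 * N" "f x < f x' \<or> f x = f x' \<and> x < x'" for x x'
  proof -
    have "B x \<subset> B x'" using that unfolding B_def by force
    then show ?thesis unfolding p_def by (intro psubset_card_mono finB)
  qed
  have inj: "inj_on p {..<16 * N}"
    by (intro inj_onI) (metis p_mono lessThan_iff less_irrefl linorder_neqE_nat)
  have p_less: "p x < 16 * N" if "x < 16 * N" for x
  proof -
    have "B x \<subset> {..<16 * N}" using that unfolding B_def by force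
    then show ?thesis unfolding p_def using psubset_card_mono[of "{..<16 * N}" "B x"] by simp
  qed
  have h_mono: "h x < h x'" if "x < 16 * N" "f x < f x'" for x x'
  proof -
    have "p x div 16 \<le> p x' div 16"
      using p_mono[OF that(1)] that(2) by (intro div_le_mono less_imp_le) blast
    then show ?thesis using that(2) unfolding h_def by linarith
  qed
  have refines: "f x = f x'" if "x < 16 * N" "x' < 16 * N" "h x = h x'" for x x'
    using h_mono that by (metis less_irrefl linorder_neqE_nat)
  have "card {x. x < 16 * N \<and> h x = y} \<le> 16" for y
  proof (cases "{x. x < 16 * N \<and> h x = y} = {}")
    case False
    then obtain x0 where x0: "x0 < 16 * N" "h x0 = y" by blast
    \<comment> \<open>On a fibre of \<open>h\<close> the value of \<open>f\<close> is constant, so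
      the injective \<open>p\<close> stays in one block of 16 ranks.\<close>
    have same: "p x div 16 = p x0 div 16" if "x < 16 * N" "h x = y" for x
      using refines[OF that(1) x0(1)] that x0 by (simp add: h_def)
    then have sub: "p ` {x. x < 16 * N \<and> h x = y} \<subseteq> {16 * (p x0 div 16)..<16 * (p x0 div 16) + 16}"
    proof (intro image_subsetI)
      fix x assume "x \<in> {x. x < 16 * N \<and> h x = y}"
      then have "p x div 16 = p x0 div 16" using same by blast
      then show "p x \<in> {16 * (p x0 div 16)..<16 * (p x0 div 16) + 16}"
        using div_mult_mod_eq[of "p x" 16] mod_less_divisor[of 16 "p x"] unfolding atLeastLessThan_iff by linarith
    qed
    have "inj_on p {x. x < 16 * N \<and> h x = y}"
      by (rule inj_on_subset[OF inj]) auto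
    then have "card {x. x < 16 * N \<and> h x = y} = card (p ` {x. x < 16 * N \<and> h x = y})"
      by (simp add: card_image)
    also have "\<dots> \<le> 16" using card_mono[OF _ sub] by simp
    finally show ?thesis .
  qed (simp only: card.empty)
  moreover have "h x < 2 * N" if "x < 16 * N" for x
    using f[OF that] p_less[OF that] unfolding h_def by (simp add: less_mult_imp_div_less)
  ultimately show ?thesis using refines by blast
qed

text \<open>
  A set of equations in which every variable occurs an even number of times involves at
  most half as many variables as it has slots.
\<close>

lemma ex_independent_system:
  assumes "N > 0"
  shows "\<exists>h :: nat \<Rightarrow> nat. (\<forall>x<16 * N. h x < 2 * N) \<and>
    (\<forall>y. card {x. x < 16 * N \<and> h x = y} \<le> 16) \<and>
    (\<forall>S \<subseteq> {..<4 * N}. S \<noteq> {} \<longrightarrow> card S \<le> N div 1728 \<longrightarrow>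
      (\<exists>y. odd (card {x \<in> slots S. h x = y})))"
proof -
  obtain f :: "nat \<Rightarrow> nat" where f: "\<And>x. x < 16 * N \<Longrightarrow> f x < N" and
    expand: "\<And>S. S \<subseteq> {..<4 * N} \<Longrightarrow> S \<noteq> {} \<Longrightarrow> card S \<le> N div 1728 \<Longrightarrow>
      2 * card S < card (f ` slots S)"
    using ex_expanding_map[OF assms] by blast
  obtain h where h: "\<forall>x<16 * N. h x < 2 * N" "\<forall>y. card {x. x < 16 * N \<and> h x = y} \<le> 16" and
    refines: "\<forall>x<16 * N. \<forall>x'<16 * N. h x = h x' \<longrightarrow> f x = f x'"
    using ex_bounded_refinement[of N f, OF f] by blast
  have "\<exists>y. odd (card {x \<in> slots S. h x = y})"
    if S: "S \<subseteq> {..<4 * N}" "S \<noteq> {}" "card S \<le> N div 1728" for S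
  proof (rule ccontr)
    assume "\<nexists>y. odd (card {x \<in> slots S. h x = y})"
    then have even: "even (card {x \<in> slots S. h x = y})" for y by blast
    have fin: "finite S" using S(1) finite_subset by blast
    have finT: "finite (slots S)" by (rule finite_slots[OF fin])
    have ge: "2 \<le> card {x \<in> slots S. h x = y}" if "y \<in> h ` slots S" for y
    proof -
      have "card {x \<in> slots S. h x = y} \<noteq> 0" using that finT by auto
      then show ?thesis using even[of y] by presburger
    qed
    \<comment> \<open>On \<open>slots S\<close> the map \<open>f\<close> factors through
      \<open>h\<close>, so \<open>h\<close> takes at least as many values there.\<close>
    have "f ` slots S \<subseteq> (\<lambda>y. f (SOME x. x \<in> slots S \<and> h x = y)) ` (h ` slots S)"
    proof
      fix z assume "z \<in> f ` slots S"
      then obtain x where x: "x \<in> slots S" "z = f x" by blast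
      let ?x = "SOME x'. x' \<in> slots S \<and> h x' = h x"
      have "?x \<in> slots S \<and> h ?x = h x"
        by (rule someI[of _ x]) (simp add: x)
      then have "f ?x = f x"
        using refines slots_subset[OF S(1)] x(1) by (meson lessThan_iff subsetD)
      then show "z \<in> (\<lambda>y. f (SOME x. x \<in> slots S \<and> h x = y)) ` (h ` slots S)"
        using x by (intro image_eqI[where x = "h x"] imageI) simp_all
    qed
    then have "card (f ` slots S) \<le> card (h ` slots S)"
      using finT by (meson card_image_le card_mono finite_imageI order.trans)
    then have "2 * card (f ` slots S) \<le> (\<Sum>y\<in>h ` slots S. 2)" by simp
    also have "\<dots> \<le> (\<Sum>y\<in>h ` slots S. card {x \<in> slots S. h x = y})"
      by (intro sum_mono ge)
    also have "\<dots> = card (slots S)"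
      using sum.image_gen[OF finT, of "\<lambda>_. 1::nat" h] by simp
    also have "\<dots> = 4 * card S" by (rule card_slots[OF fin])
    finally show False using expand[OF S] by simp
  qed
  with h show ?thesis by blast
qed

section \<open>Parities and decision trees\<close>

text \<open>The left-hand side of equation \<open>i\<close> when exactly the variables in
  \<open>X\<close> are 1. Slots are counted because a variable may occur repeatedly in one
  equation.\<close>

definition parity :: "(nat \<Rightarrow> nat) \<Rightarrow> nat set \<Rightarrow> nat \<Rightarrow> bool" where
  "parity h X i \<longleftrightarrow> odd (card {x \<in> slots {i}. h x \<in> X})"

definition sgn_bit :: "bool \<Rightarrow> int" where
  "sgn_bit b = (if b then -1 else 1)"

lemma prod_sgn_bit:
  "finite A \<Longrightarrow> (\<Prod>x\<in>A. sgn_bit (P x)) = sgn_bit (odd (card {x \<in> A. P x}))"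
proof (induction A rule: finite_induct)
  case (insert a A)
  have "{x \<in> insert a A. P x} = (if P a then insert a {x \<in> A. P x} else {x \<in> A. P x})" by auto
  with insert show ?case by (auto simp: sgn_bit_def)
qed (simp add: sgn_bit_def)

lemma prod_sgn_parity:
  assumes "finite S"
  shows "(\<Prod>i\<in>S. sgn_bit (parity h X i)) = (\<Prod>x\<in>slots S. sgn_bit (h x \<in> X))"
proof -
  have "(\<Prod>i\<in>S. sgn_bit (parity h X i)) = (\<Prod>i\<in>S. \<Prod>x\<in>slots {i}. sgn_bit (h x \<in> X))"
    unfolding parity_def by (simp add: prod_sgn_bit finite_slots)
  also have "\<dots> = (\<Prod>x\<in>(\<Union>i\<in>S. slots {i}). sgn_bit (h x \<in> X))"
    by (rule prod.UNION_disjoint[symmetric, OF assms]) (simp add: finite_slots, auto simp: slots_def)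
  also have "(\<Union>i\<in>S. slots {i}) = slots S" by (auto simp: slots_def)
  finally show ?thesis .
qed

text \<open>Toggling \<open>y\<close> in \<open>X\<close> is an involution that flips the sign of
  the product, because \<open>y\<close> fills an odd number of slots of \<open>S\<close>.\<close>

lemma character_sum_eq_0:
  assumes S: "finite S" and odd: "odd (card {x \<in> slots S. h x = y})" and y: "y < M"
  shows "(\<Sum>X\<in>Pow {..<M}. \<Prod>i\<in>S. sgn_bit (parity h X i)) = 0"
proof -
  let ?F = "\<lambda>X. \<Prod>i\<in>S. sgn_bit (parity h X i)"
  have flip: "?F (sym_diff X {y}) = - ?F X" for X
  proof -
    have "?F (sym_diff X {y}) = (\<Prod>x\<in>slots S. sgn_bit (h x \<in> X) * sgn_bit (h x = y))"
      unfolding prod_sgn_parity[OF S] by (intro prod.cong) (auto simp: sgn_bit_def)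
    also have "\<dots> = ?F X * sgn_bit (odd (card {x \<in> slots S. h x = y}))"
      by (simp add: prod.distrib prod_sgn_parity S prod_sgn_bit finite_slots)
    finally show ?thesis using odd by (simp add: sgn_bit_def)
  qed
  have invol: "sym_diff (sym_diff X {y}) {y} = X" for X by blast
  have "sum ?F (Pow {..<M}) = (\<Sum>X\<in>Pow {..<M}. ?F (sym_diff X {y}))"
    by (rule sum.reindex_bij_witness[where i = "\<lambda>X. sym_diff X {y}" and j = "\<lambda>X. sym_diff X {y}"])
       (use y in \<open>auto simp: invol\<close>)
  also have "\<dots> = - sum ?F (Pow {..<M})"
    by (simp add: flip sum_negf)
  finally show ?thesis by simp
qed

text \<open>
  Fourier expansion of the indicator of \<open>\<forall>i\<in>Q. parity h X i = g i\<close>: only the empty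
  subset of \<open>Q\<close> contributes.
\<close>

lemma card_parity_solutions:
  assumes Q: "finite Q"
    and odd: "\<And>S. S \<subseteq> Q \<Longrightarrow> S \<noteq> {} \<Longrightarrow> \<exists>y<M. odd (card {x \<in> slots S. h x = y})"
  shows "card {X \<in> Pow {..<M}. \<forall>i\<in>Q. parity h X i = g i} * 2 ^ card Q = 2 ^ M"
proof -
  let ?s = "\<lambda>X i. sgn_bit (parity h X i)" and ?g = "\<lambda>i. sgn_bit (g i)"
  \<comment> \<open>Each factor is 2 where the bits agree and 0 where they differ.\<close>
  have ind: "(\<Prod>i\<in>Q. ?s X i * ?g i + 1) = (if \<forall>i\<in>Q. parity h X i = g i then 2 ^ card Q else 0)" for X
  proof (cases "\<forall>i\<in>Q. parity h X i = g i")
    case True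
    then have "(\<Prod>i\<in>Q. ?s X i * ?g i + 1) = (\<Prod>i\<in>Q. 2)"
      by (intro prod.cong) (auto simp: sgn_bit_def)
    with True show ?thesis by simp
  next
    case False
    then have "\<exists>i\<in>Q. ?s X i * ?g i + 1 = 0" by (auto simp: sgn_bit_def)
    with False Q show ?thesis by (simp only: if_False prod_zero)
  qed
  have "int (card {X \<in> Pow {..<M}. \<forall>i\<in>Q. parity h X i = g i} * 2 ^ card Q)
      = (\<Sum>X\<in>Pow {..<M}. \<Prod>i\<in>Q. ?s X i * ?g i + 1)"
    by (simp add: ind sum.If_cases Int_def)
  also have "\<dots> = (\<Sum>X\<in>Pow {..<M}. \<Sum>S\<in>Pow Q. \<Prod>i\<in>S. ?s X i * ?g i)"
    by (simp add: prod_add[OF Q])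
  also have "\<dots> = (\<Sum>S\<in>Pow Q. (\<Sum>X\<in>Pow {..<M}. \<Prod>i\<in>S. ?s X i) * (\<Prod>i\<in>S. ?g i))"
    by (subst sum.swap) (simp add: prod.distrib sum_distrib_right)
  also have "\<dots> = (\<Sum>S\<in>Pow Q. if S = {} then 2 ^ M else 0)"
  proof (intro sum.cong refl)
    fix S assume S: "S \<in> Pow Q"
    show "(\<Sum>X\<in>Pow {..<M}. \<Prod>i\<in>S. ?s X i) * (\<Prod>i\<in>S. ?g i) = (if S = {} then 2 ^ M else 0)"
    proof (cases "S = {}")
      case False
      with S odd[of S] obtain y where "y < M" "odd (card {x \<in> slots S. h x = y})" by blast
      moreover have "finite S" using S Q finite_subset by blast
      ultimately have "(\<Sum>X\<in>Pow {..<M}. \<Prod>i\<in>S. ?s X i) = 0"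
        by (intro character_sum_eq_0)
      with False show ?thesis by simp
    qed (simp add: card_Pow)
  qed
  also have "\<dots> = 2 ^ M" using Q by simp
  also have "\<dots> = int (2 ^ M)" by simp
  finally show ?thesis by (simp only: of_nat_eq_iff)
qed

text \<open>The balls of radius \<open>N / 3\<close> around the \<open>2 ^ (2 * N)\<close> vectors
  \<open>\<Phi> X\<close> are too small to cover all \<open>2 ^ (4 * N)\<close> vectors.\<close>

lemma ex_far_from_all:
  fixes \<Phi> :: "nat set \<Rightarrow> nat \<Rightarrow> bool"
  assumes N: "N > 0"
  shows "\<exists>b. \<forall>X\<in>Pow {..<2 * N}. N < 3 * card {i \<in> {..<4 * N}. \<Phi> X i \<noteq> b i}"
proof -
  define V where "V = {D \<in> Pow {..<4 * N}. 3 * card D \<le> N}"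
  define f where "f = (\<lambda>(X, D). sym_diff {i \<in> {..<4 * N}. \<Phi> X i} D)"
  have finV: "finite V" unfolding V_def by simp
  have "real (card V) = (\<Sum>D\<in>V. 1)" by simp
  \<comment> \<open>Sets in \<open>V\<close> have weight at least 1. Over all subsets the weights
    sum to a product, and it suffices that \<open>8 * (9 / 8) ^ 4 < 16\<close>.\<close>
  also have "\<dots> \<le> (\<Sum>D\<in>V. 2 ^ N * (1 / 8) ^ card D)"
  proof (intro sum_mono)
    fix D assume "D \<in> V"
    then have "(2 :: real) ^ (3 * card D) \<le> 2 ^ N"
      unfolding V_def by (intro power_increasing) auto
    then show "1 \<le> 2 ^ N * (1 / 8 :: real) ^ card D"
      by (simp add: power_mult power_divide)
  qed
  also have "\<dots> \<le> (\<Sum>D\<in>Pow {..<4 * N}. 2 ^ N * (1 / 8) ^ card D)"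
    by (intro sum_mono2) (auto simp: V_def)
  also have "\<dots> = 2 ^ N * (\<Sum>D\<in>Pow {..<4 * N}. \<Prod>i\<in>D. 1 / 8)"
    by (simp add: sum_distrib_left)
  also have "\<dots> = 2 ^ N * (9 / 8) ^ (4 * N)"
    using prod_add[of "{..<4 * N}" "\<lambda>_. 1 / 8 :: real" "\<lambda>_. 1"] by simp
  finally have "2 ^ (2 * N) * real (card V) \<le> 2 ^ (2 * N) * (2 ^ N * (9 / 8) ^ (4 * N))"
    by (intro mult_left_mono) auto
  also have "\<dots> = (2\<^sup>2 * 2 * (9 / 8) ^ 4) ^ N"
    by (simp only: power_mult_distrib power_mult)
  also have "\<dots> < (2 ^ 4) ^ N"
    using N by (intro power_strict_mono) (simp_all add: power_divide)
  finally have "real (2 ^ (2 * N) * card V) < real (2 ^ (4 * N))"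
    by (simp add: power_mult)
  then have less: "2 ^ (2 * N) * card V < 2 ^ (4 * N)" by (simp only: of_nat_less_iff)
  have "card (f ` (Pow {..<2 * N} \<times> V)) \<le> 2 ^ (2 * N) * card V"
    using card_image_le[of "Pow {..<2 * N} \<times> V" f] finV
    by (simp add: card_cartesian_product card_Pow)
  with less have less': "card (f ` (Pow {..<2 * N} \<times> V)) < card (Pow {..<4 * N})"
    by (simp add: card_Pow)
  then have "\<not> Pow {..<4 * N} \<subseteq> f ` (Pow {..<2 * N} \<times> V)"
  proof -
    have "finite (f ` (Pow {..<2 * N} \<times> V))" using finV by simp
    from card_mono[OF this] less' show ?thesis by (meson linorder_not_less)
  qed
  then obtain B where B: "B \<subseteq> {..<4 * N}" "B \<notin> f ` (Pow {..<2 * N} \<times> V)" by blast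
  have "N < 3 * card {i \<in> {..<4 * N}. \<Phi> X i \<noteq> (i \<in> B)}" if X: "X \<in> Pow {..<2 * N}" for X
  proof (rule ccontr)
    let ?D = "{i \<in> {..<4 * N}. \<Phi> X i \<noteq> (i \<in> B)}"
    assume "\<not> N < 3 * card ?D"
    then have "?D \<in> V" by (auto simp: V_def)
    then have "f (X, ?D) \<in> f ` (Pow {..<2 * N} \<times> V)" using X by (intro imageI SigmaI)
    moreover have "f (X, ?D) = B" using B(1) by (auto simp: f_def)
    ultimately show False using B(2) by simp
  qed
  then show ?thesis by (intro exI[of _ "\<lambda>i. i \<in> B"] ballI)
qed

text \<open>
  Induction on the tree: \<open>Q\<close> is the set of bits that the queries made so far depend on, and
  conditioning on one more bit fixes the next answer.
\<close>

lemma card_accepts_eq: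
  fixes tab :: "(nat \<Rightarrow> bool) \<Rightarrow> table" and F G :: "'w \<Rightarrow> nat \<Rightarrow> bool"
  assumes fin: "finite \<Omega>"
    and local: "\<And>b b' v j. b (q v) = b' (q v) \<Longrightarrow> answer (tab b) v j = answer (tab b') v j"
    and q: "\<And>v. q v < m"
    and same: "\<And>Q g. Q \<subseteq> {..<m} \<Longrightarrow> card Q \<le> K \<Longrightarrow>
      card {w \<in> \<Omega>. \<forall>i\<in>Q. F w i = g i} = card {w \<in> \<Omega>. \<forall>i\<in>Q. G w i = g i}"
    and queries: "\<And>b. num_queries T (tab b) \<le> K"
  shows "card {w \<in> \<Omega>. accepts T (tab (F w))} = card {w \<in> \<Omega>. accepts T (tab (G w))}"
proof -
  have "card {w \<in> \<Omega>. (\<forall>i\<in>Q. F w i = g i) \<and> accepts T (tab (F w))} =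
        card {w \<in> \<Omega>. (\<forall>i\<in>Q. G w i = g i) \<and> accepts T (tab (G w))}"
    if "Q \<subseteq> {..<m}" "\<And>b. (\<forall>i\<in>Q. b i = g i) \<Longrightarrow> card Q + num_queries T (tab b) \<le> K" for Q g
    using that
  proof (induction T arbitrary: Q g)
    case (Decide a)
    have "card Q \<le> K" using Decide(2)[of g] by simp
    then show ?case using same[OF Decide(1)] by (cases a) simp_all
  next
    case (Query v j k)
    \<comment> \<open>Only two answers are possible, and constant bit vectors produce them.\<close>
    define a where "a \<beta> = answer (tab (\<lambda>_. \<beta>)) v j" for \<beta>
    have ans: "answer (tab b) v j = a (b (q v))" for b
      unfolding a_def by (rule local) simp
    have finQ: "finite Q" using Query.prems(1) finite_subset by blast
    show ?case
    proof (cases "q v \<in> Q")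
      case True
      let ?a = "a (g (q v))"
      have eq: "{w \<in> \<Omega>. (\<forall>i\<in>Q. H w i = g i) \<and> accepts (Query v j k) (tab (H w))} =
          {w \<in> \<Omega>. (\<forall>i\<in>Q. H w i = g i) \<and> accepts (k ?a) (tab (H w))}" for H :: "'w \<Rightarrow> nat \<Rightarrow> bool"
        using True by (auto simp: ans)
      show ?thesis unfolding eq
      proof (rule Query.IH[OF _ Query.prems(1)])
        fix b assume b: "\<forall>i\<in>Q. b i = g i"
        then show "card Q + num_queries (k ?a) (tab b) \<le> K"
          using Query.prems(2)[OF b] True by (simp add: ans)
      qed simp
    next
      case False
      \<comment> \<open>Splitting on a new bit adds one element to \<open>Q\<close> and spends one
        query, so the sum bounded by \<open>K\<close> is preserved.\<close>
      define R where "R H \<beta> = {w \<in> \<Omega>. (\<forall>i\<in>insert (q v) Q. H w i = (g(q v := \<beta>)) i) \<and>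
          accepts (k (a \<beta>)) (tab (H w))}" for H :: "'w \<Rightarrow> nat \<Rightarrow> bool" and \<beta>
      have cond: "(\<forall>i\<in>insert (q v) Q. b i = (g(q v := \<beta>)) i) \<longleftrightarrow> b (q v) = \<beta> \<and> (\<forall>i\<in>Q. b i = g i)"
        for b \<beta>
      proof -
        have "(\<forall>i\<in>Q. b i = (g(q v := \<beta>)) i) \<longleftrightarrow> (\<forall>i\<in>Q. b i = g i)"
          using False by (intro ball_cong refl) (metis fun_upd_other)
        then show ?thesis unfolding ball_simps fun_upd_same by simp
      qed
      have split: "card {w \<in> \<Omega>. (\<forall>i\<in>Q. H w i = g i) \<and> accepts (Query v j k) (tab (H w))} =
          card (R H True) + card (R H False)" for H
      proof -
        have "{w \<in> \<Omega>. (\<forall>i\<in>Q. H w i = g i) \<and> accepts (Query v j k) (tab (H w))} =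
            R H True \<union> R H False"
        proof (intro set_eqI)
          fix w
          have "w \<in> R H \<beta> \<longleftrightarrow> w \<in> \<Omega> \<and> H w (q v) = \<beta> \<and> (\<forall>i\<in>Q. H w i = g i) \<and>
              accepts (k (a \<beta>)) (tab (H w))" for \<beta>
            unfolding R_def mem_Collect_eq cond by blast
          then show "w \<in> {w \<in> \<Omega>. (\<forall>i\<in>Q. H w i = g i) \<and> accepts (Query v j k) (tab (H w))} \<longleftrightarrow>
              w \<in> R H True \<union> R H False"
            by (cases "H w (q v)") (simp_all add: ans)
        qed
        moreover have "R H True \<inter> R H False = {}" unfolding R_def by auto
        ultimately show ?thesis
          using fin card_Un_disjoint[of "R H True" "R H False"] by (simp add: R_def)
      qed
      have "card (R F \<beta>) = card (R G \<beta>)" for \<beta>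
        unfolding R_def
      proof (rule Query.IH)
        show "insert (q v) Q \<subseteq> {..<m}" using Query.prems(1) q by auto
        fix b assume b: "\<forall>i\<in>insert (q v) Q. b i = (g(q v := \<beta>)) i"
        then have bQ: "b (q v) = \<beta>" "\<forall>i\<in>Q. b i = g i" unfolding cond by blast+
        from Query.prems(2)[OF bQ(2)] show "card (insert (q v) Q) + num_queries (k (a \<beta>)) (tab b) \<le> K"
          using bQ(1) False finQ by (simp add: ans)
      qed simp
      then show ?thesis unfolding split by simp
    qed
  qed
  from this[of "{}"] show ?thesis using queries by simp
qed

section \<open>The gadget of an equation\<close>

text \<open>
  The ids of a gadget are: 0 to 11 the vertices of its four variables, 12 to 23 those of four
  auxiliary triangles, 24, 25, 26 a palette \<open>p0, p1, p2\<close>, 27 to 32 three pairs \<open>b, b'\<close>,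
  \<open>u, u'\<close>, \<open>w, w'\<close>, each of which forms a triangle with \<open>p2\<close>, 33 to 36 vertices
  \<open>f1, e1, f2, e2\<close>, and 37 to 70 third vertices of hyperedges that merely force two vertices
  to differ.

  If corresponding vertices of two rainbow triangles differ, the colours are shifted
  cyclically, so the signs agree; two such layers allow every pair of triangles of
  the same sign. This links the first variable with the palette, in which the flag \<open>\<beta>\<close>
  swaps \<open>p0\<close> and \<open>p1\<close>, and the other three with the three pairs. The last ten
  inequalities express that \<open>w\<close> is the sum of \<open>b\<close> and \<open>u\<close>, where the colour of
  \<open>p0\<close> stands for 0 and that of \<open>p1\<close> for 1: if \<open>b = p0\<close> then \<open>f2 = p2\<close>, so
  \<open>e2\<close> forces \<open>u = w\<close>, and if \<open>b = p1\<close> then \<open>f1 = p2\<close>, so \<open>e1\<close> forces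
  \<open>u' = w\<close>.
\<close>

definition rainbow :: "(nat \<Rightarrow> nat) \<Rightarrow> nat \<times> nat \<times> nat \<Rightarrow> bool" where
  "rainbow c = (\<lambda>(x, y, z). c x \<noteq> c y \<and> c y \<noteq> c z \<and> c x \<noteq> c z)"

definition neq_pairs :: "bool \<Rightarrow> (nat \<times> nat) list" where
  "neq_pairs \<beta> =
    [(0, 12), (1, 13), (2, 14), (3, 15), (4, 16), (5, 17),
     (6, 18), (7, 19), (8, 20), (9, 21), (10, 22), (11, 23),
     (12, if \<beta> then 25 else 24), (13, if \<beta> then 24 else 25), (14, 26), (15, 27), (16, 28), (17, 26),
     (18, 29), (19, 30), (20, 26), (21, 31), (22, 32), (23, 26),
     (33, 24), (33, 27), (34, 33), (34, 30), (34, 31), (35, 25), (35, 27), (36, 35), (36, 29), (36, 31)]"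

definition triangles :: "(nat \<times> nat \<times> nat) list" where
  "triangles =
    [(0, 1, 2), (3, 4, 5), (6, 7, 8), (9, 10, 11), (12, 13, 14), (15, 16, 17), (18, 19, 20),
     (21, 22, 23), (24, 25, 26), (27, 28, 26), (29, 30, 26), (31, 32, 26)]"

definition gadget :: "bool \<Rightarrow> (nat \<times> nat \<times> nat) list" where
  "gadget \<beta> = triangles @ map (\<lambda>((x, y), z). (x, y, z)) (zip (neq_pairs \<beta>) [37..<71])"

text \<open>The first two entries of the odd permutations of 1, 2, 3; they determine the
  third.\<close>

definition odd_colours :: "nat \<Rightarrow> nat \<Rightarrow> bool" where
  "odd_colours x y \<longleftrightarrow> (x, y) \<in> {(1, 3), (2, 1), (3, 2)}"

definition std_colours :: "bool \<Rightarrow> nat list" where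
  "std_colours s = (if s then [2, 1, 3] else [1, 2, 3])"

lemma length_gadget: "length (gadget \<beta>) = 46"
proof -
  have "\<forall>\<beta>. length (gadget \<beta>) = 46" by code_simp
  then show ?thesis by blast
qed

text \<open>Two variables of an equation may coincide. The last three claims keep the vertices of a
  hyperedge distinct even then.\<close>

lemma gadget_edge:
  assumes "(x, y, z) \<in> set (gadget \<beta>)"
  shows "x < 71 \<and> y < 71 \<and> z < 71 \<and> x \<noteq> y \<and> y \<noteq> z \<and> x \<noteq> z"
    and "x < 12 \<Longrightarrow> y < 12 \<Longrightarrow> x div 3 = y div 3"
    and "y < 12 \<Longrightarrow> z < 12 \<Longrightarrow> y div 3 = z div 3"
    and "x < 12 \<Longrightarrow> z < 12 \<Longrightarrow> x div 3 = z div 3"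
proof -
  have "\<forall>\<beta>. \<forall>(x, y, z)\<in>set (gadget \<beta>).
      (x < 71 \<and> y < 71 \<and> z < 71 \<and> x \<noteq> y \<and> y \<noteq> z \<and> x \<noteq> z) \<and>
      (x < 12 \<longrightarrow> y < 12 \<longrightarrow> x div 3 = y div 3) \<and> (y < 12 \<longrightarrow> z < 12 \<longrightarrow> y div 3 = z div 3) \<and>
      (x < 12 \<longrightarrow> z < 12 \<longrightarrow> x div 3 = z div 3)"
    by code_simp
  with assms show "x < 71 \<and> y < 71 \<and> z < 71 \<and> x \<noteq> y \<and> y \<noteq> z \<and> x \<noteq> z"
    "x < 12 \<Longrightarrow> y < 12 \<Longrightarrow> x div 3 = y div 3" "y < 12 \<Longrightarrow> z < 12 \<Longrightarrow> y div 3 = z div 3"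
    "x < 12 \<Longrightarrow> z < 12 \<Longrightarrow> x div 3 = z div 3"
    by blast+
qed

text \<open>The flag only enters the inequalities at 12 and 13, whose hyperedges consist of private
  vertices.\<close>

lemma gadget_edge_variable:
  assumes "(x, y, z) \<in> set (gadget \<beta>)" "x < 12 \<or> y < 12 \<or> z < 12"
  shows "(x, y, z) \<in> set (gadget \<beta>')"
proof -
  have "\<forall>\<beta> \<beta>'. \<forall>(x, y, z)\<in>set (gadget \<beta>).
      x < 12 \<or> y < 12 \<or> z < 12 \<longrightarrow> (x, y, z) \<in> set (gadget \<beta>')"
    by code_simp
  with assms show ?thesis by blast
qed

section \<open>Permutations of three colours\<close>

lemma colour_cases:
  assumes "{a, b, c, x} \<subseteq> {1, 2, 3 :: nat}" "a \<noteq> b" "b \<noteq> c" "a \<noteq> c"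
  shows "x = a \<or> x = b \<or> x = c"
proof (rule ccontr)
  assume "\<not> ?thesis"
  then have "card {x, a, b, c} = 4" using assms(2-4) by auto
  moreover have "card {x, a, b, c} \<le> card {1, 2, 3 :: nat}"
    using assms(1) by (intro card_mono) auto
  ultimately show False by simp
qed

text \<open>A permutation of three colours without fixed points is a 3-cycle, hence even.\<close>

lemma same_orientation:
  assumes "{x0, x1, x2, y0, y1, y2} \<subseteq> {1, 2, 3 :: nat}"
    and x: "x0 \<noteq> x1" "x1 \<noteq> x2" "x0 \<noteq> x2" and y: "y0 \<noteq> y1" "y1 \<noteq> y2" "y0 \<noteq> y2"
    and "x0 \<noteq> y0" "x1 \<noteq> y1" "x2 \<noteq> y2"
  shows "odd_colours x0 x1 = odd_colours y0 y1"
proof -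
  have "y0 = x0 \<or> y0 = x1 \<or> y0 = x2" "y1 = x0 \<or> y1 = x1 \<or> y1 = x2" "y2 = x0 \<or> y2 = x1 \<or> y2 = x2"
    by (rule colour_cases[OF _ x], use assms(1) in blast)+
  with assms(2-) have "y0 = x1 \<and> y1 = x2 \<or> y0 = x2 \<and> y1 = x0" by blast
  moreover have "{x0, x1, x2} \<subseteq> {1, 2, 3}" using assms(1) by blast
  with x have "odd_colours x0 x1 = odd_colours x1 x2 \<and> odd_colours x0 x1 = odd_colours x2 x0"
    unfolding odd_colours_def by auto
  ultimately show ?thesis by blast
qed

text \<open>Each pair avoids the colour of \<open>p2\<close>, so it is \<open>p0, p1\<close> in some
  order, and its sign is its bit plus the palette sign. The three bits sum to 0, so the signs sum to
  three copies of the palette sign, that is, to one.\<close>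

lemma xor_colours:
  assumes col: "{p0, p1, p2, b, b', u, u', w, w', f1, e1, f2, e2} \<subseteq> {1, 2, 3 :: nat}"
    and p: "p0 \<noteq> p1" "p1 \<noteq> p2" "p0 \<noteq> p2"
    and buw: "b \<noteq> b'" "b' \<noteq> p2" "b \<noteq> p2" "u \<noteq> u'" "u' \<noteq> p2" "u \<noteq> p2" "w \<noteq> w'" "w' \<noteq> p2" "w \<noteq> p2"
    and f: "f1 \<noteq> p0" "f1 \<noteq> b" "e1 \<noteq> f1" "e1 \<noteq> u'" "e1 \<noteq> w"
      "f2 \<noteq> p1" "f2 \<noteq> b" "e2 \<noteq> f2" "e2 \<noteq> u" "e2 \<noteq> w"
  shows "(odd_colours b b' \<noteq> (odd_colours u u' \<noteq> odd_colours w w')) = odd_colours p0 p1"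
proof -
  have c: "x = p0 \<or> x = p1 \<or> x = p2" if "x \<in> {b, b', u, u', w, w', f1, e1, f2, e2}" for x
    by (rule colour_cases[OF _ p]) (use col that in blast)
  have "b = p0 \<and> b' = p1 \<or> b = p1 \<and> b' = p0" "u = p0 \<and> u' = p1 \<or> u = p1 \<and> u' = p0"
    "w = p0 \<and> w' = p1 \<or> w = p1 \<and> w' = p0"
    using c[of b] c[of b'] c[of u] c[of u'] c[of w] c[of w'] buw by auto
  moreover have "w = u" if "b = p0"
    using c[of f2] c[of e2] c[of w] c[of u] f buw that by auto
  moreover have "w = u'" if "b = p1"
    using c[of f1] c[of e1] c[of w] c[of u'] f buw that by auto
  moreover have "{p0, p1} \<subseteq> {1, 2, 3}" using col by blast
  with p(1) have "odd_colours p1 p0 = (\<not> odd_colours p0 p1)"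
    unfolding odd_colours_def by auto
  ultimately show ?thesis using p(1) by metis
qed

text \<open>The palette sign is the sum of the last three signs by \<open>xor_colours\<close>, and
  the first sign plus \<open>\<beta>\<close> by the linking layers.\<close>

lemma gadget_sound:
  assumes c: "\<And>k. k < 71 \<Longrightarrow> c k \<in> {1, 2, 3}"
    and "\<forall>t\<in>set (gadget \<beta>). rainbow c t"
  shows "(odd_colours (c 0) (c 1) \<noteq> (odd_colours (c 3) (c 4) \<noteq>
    (odd_colours (c 6) (c 7) \<noteq> odd_colours (c 9) (c 10)))) = \<beta>"
proof -
  note edges = assms(2)[unfolded gadget_def triangles_def neq_pairs_def rainbow_def]
  have e: "c 0 \<noteq> c 1 \<and> c 1 \<noteq> c 2 \<and> c 0 \<noteq> c 2 \<and>
    c 3 \<noteq> c 4 \<and> c 4 \<noteq> c 5 \<and> c 3 \<noteq> c 5 \<and>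
    c 6 \<noteq> c 7 \<and> c 7 \<noteq> c 8 \<and> c 6 \<noteq> c 8 \<and>
    c 9 \<noteq> c 10 \<and> c 10 \<noteq> c 11 \<and> c 9 \<noteq> c 11 \<and>
    c 12 \<noteq> c 13 \<and> c 13 \<noteq> c 14 \<and> c 12 \<noteq> c 14 \<and>
    c 15 \<noteq> c 16 \<and> c 16 \<noteq> c 17 \<and> c 15 \<noteq> c 17 \<and>
    c 18 \<noteq> c 19 \<and> c 19 \<noteq> c 20 \<and> c 18 \<noteq> c 20 \<and>
    c 21 \<noteq> c 22 \<and> c 22 \<noteq> c 23 \<and> c 21 \<noteq> c 23 \<and>
    c 24 \<noteq> c 25 \<and> c 25 \<noteq> c 26 \<and> c 24 \<noteq> c 26 \<and>
    c 27 \<noteq> c 28 \<and> c 28 \<noteq> c 26 \<and> c 27 \<noteq> c 26 \<and>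
    c 29 \<noteq> c 30 \<and> c 30 \<noteq> c 26 \<and> c 29 \<noteq> c 26 \<and>
    c 31 \<noteq> c 32 \<and> c 32 \<noteq> c 26 \<and> c 31 \<noteq> c 26 \<and>
    c 0 \<noteq> c 12 \<and> c 1 \<noteq> c 13 \<and> c 2 \<noteq> c 14 \<and>
    c 3 \<noteq> c 15 \<and> c 4 \<noteq> c 16 \<and> c 5 \<noteq> c 17 \<and>
    c 6 \<noteq> c 18 \<and> c 7 \<noteq> c 19 \<and> c 8 \<noteq> c 20 \<and>
    c 9 \<noteq> c 21 \<and> c 10 \<noteq> c 22 \<and> c 11 \<noteq> c 23 \<and>
    c 14 \<noteq> c 26 \<and> c 15 \<noteq> c 27 \<and> c 16 \<noteq> c 28 \<and>
    c 17 \<noteq> c 26 \<and> c 18 \<noteq> c 29 \<and> c 19 \<noteq> c 30 \<and>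
    c 20 \<noteq> c 26 \<and> c 21 \<noteq> c 31 \<and> c 22 \<noteq> c 32 \<and>
    c 23 \<noteq> c 26 \<and> c 33 \<noteq> c 24 \<and> c 33 \<noteq> c 27 \<and>
    c 34 \<noteq> c 33 \<and> c 34 \<noteq> c 30 \<and> c 34 \<noteq> c 31 \<and>
    c 35 \<noteq> c 25 \<and> c 35 \<noteq> c 27 \<and> c 36 \<noteq> c 35 \<and>
    c 36 \<noteq> c 29 \<and> c 36 \<noteq> c 31"
    using edges by simp
  have flag: "c 12 \<noteq> c (if \<beta> then 25 else 24) \<and> c 13 \<noteq> c (if \<beta> then 24 else 25)"
    using edges by (cases \<beta>) simp_all
  have "odd_colours (c 0) (c 1) = odd_colours (c 12) (c 13)"
    by (rule same_orientation[of _ _ "c 2" _ _ "c 14"]) (use c e in simp_all)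
  moreover have "odd_colours (c 12) (c 13) =
      odd_colours (c (if \<beta> then 25 else 24)) (c (if \<beta> then 24 else 25))"
    by (rule same_orientation[of _ _ "c 14" _ _ "c 26"]) (use c e flag in auto)
  moreover have "c 24 \<noteq> c 25" using e by simp
  then have "odd_colours (c 25) (c 24) = (\<not> odd_colours (c 24) (c 25))"
    using c[of 24] c[of 25] unfolding odd_colours_def by auto
  moreover have "odd_colours (c 3) (c 4) = odd_colours (c 15) (c 16)"
    by (rule same_orientation[of _ _ "c 5" _ _ "c 17"]) (use c e in simp_all)
  moreover have "odd_colours (c 15) (c 16) = odd_colours (c 27) (c 28)"
    by (rule same_orientation[of _ _ "c 17" _ _ "c 26"]) (use c e in simp_all)
  moreover have "odd_colours (c 6) (c 7) = odd_colours (c 18) (c 19)"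
    by (rule same_orientation[of _ _ "c 8" _ _ "c 20"]) (use c e in simp_all)
  moreover have "odd_colours (c 18) (c 19) = odd_colours (c 29) (c 30)"
    by (rule same_orientation[of _ _ "c 20" _ _ "c 26"]) (use c e in simp_all)
  moreover have "odd_colours (c 9) (c 10) = odd_colours (c 21) (c 22)"
    by (rule same_orientation[of _ _ "c 11" _ _ "c 23"]) (use c e in simp_all)
  moreover have "odd_colours (c 21) (c 22) = odd_colours (c 31) (c 32)"
    by (rule same_orientation[of _ _ "c 23" _ _ "c 26"]) (use c e in simp_all)
  moreover have "(odd_colours (c 27) (c 28) \<noteq> (odd_colours (c 29) (c 30) \<noteq> odd_colours (c 31) (c 32)))
      = odd_colours (c 24) (c 25)"
    by (rule xor_colours[of _ _ "c 26" _ _ _ _ _ _ "c 33" "c 34" "c 35" "c 36"]) (use c e in simp_all)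
  ultimately show ?thesis by (cases \<beta>) auto
qed

text \<open>
  Only the ids below 37 are listed; the remaining vertices get the third colour of their hyperedge.
\<close>

definition gadget_colours :: "bool \<Rightarrow> bool \<Rightarrow> bool \<Rightarrow> bool \<Rightarrow> nat list" where
  "gadget_colours s0 s1 s2 s3 =
    (let shifted = (\<lambda>s. if s then [1, 3, 2] else [2, 3, 1]);
         p = (s1 \<noteq> (s2 \<noteq> s3)); P = std_colours p; U = std_colours s2
     in concat (map std_colours [s0, s1, s2, s3]) @ concat (map shifted [s0, s1, s2, s3]) @ P @
        concat (map (\<lambda>s. take 2 (std_colours s)) [s1, s2, s3]) @
        (if s1 = p then [P ! 1, 3, 3, U ! 1] else [3, U ! 0, P ! 0, 3]))"

text \<open>A check of all sixteen sign patterns. The palette, read in the order set by the flag,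
  has the sign of the first variable, so one shifted triangle differs from both its
  neighbours.\<close>

lemma gadget_colours:
  fixes s0 s1 s2 s3 :: bool
  defines "\<beta> \<equiv> s0 \<noteq> (s1 \<noteq> (s2 \<noteq> s3))" and "c \<equiv> gadget_colours s0 s1 s2 s3"
  shows "length c = 37" "set c \<subseteq> {1, 2, 3}" "take 12 c = concat (map std_colours [s0, s1, s2, s3])"
    "\<forall>t\<in>set triangles. rainbow (\<lambda>k. c ! k) t"
    "\<forall>(x, y)\<in>set (neq_pairs \<beta>). c ! x \<noteq> c ! y"
  unfolding assms
  by (cases s0; cases s1; cases s2; cases s3;
      simp add: gadget_colours_def std_colours_def triangles_def rainbow_def neq_pairs_def)+

lemma neq_pairs_less: "(x, y) \<in> set (neq_pairs \<beta>) \<Longrightarrow> x < 37 \<and> y < 37"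
  unfolding neq_pairs_def by auto

text \<open>The colours of a variable depend on its own sign alone, so gadgets sharing a variable
  agree on it.\<close>

lemma gadget_complete:
  fixes s :: "nat \<Rightarrow> bool"
  assumes "(s 0 \<noteq> (s 1 \<noteq> (s 2 \<noteq> s 3))) = \<beta>"
  shows "\<exists>c. (\<forall>k<71. c k \<in> {1, 2, 3}) \<and> (\<forall>k<12. c k = std_colours (s (k div 3)) ! (k mod 3)) \<and>
    (\<forall>t\<in>set (gadget \<beta>). rainbow c t)"
proof -
  define cs where "cs = gadget_colours (s 0) (s 1) (s 2) (s 3)"
  \<comment> \<open>Given two of the colours 1, 2, 3, the third is 6 minus their sum.\<close>
  define c where "c k = (if k < 37 then cs ! k
    else (case neq_pairs \<beta> ! (k - 37) of (x, y) \<Rightarrow> 6 - (cs ! x + cs ! y)))" for k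
  note cs = gadget_colours[of "s 0" "s 1" "s 2" "s 3", folded cs_def, unfolded assms]
  have len: "length (neq_pairs \<beta>) = 34" by (simp add: neq_pairs_def)
  have cs123: "cs ! k = 1 \<or> cs ! k = 2 \<or> cs ! k = 3" if "k < 37" for k
    using subsetD[OF cs(2) nth_mem[of k cs]] cs(1) that by simp
  have fresh: "c x = cs ! x \<and> c y = cs ! y \<and> cs ! x \<noteq> cs ! y \<and> c (37 + i) = 6 - (cs ! x + cs ! y) \<and>
      x < 37 \<and> y < 37"
    if "neq_pairs \<beta> ! i = (x, y)" "i < 34" for i x y
  proof -
    have xy: "(x, y) \<in> set (neq_pairs \<beta>)" using that len by (metis nth_mem)
    then show ?thesis using cs(5) neq_pairs_less[OF xy] that by (auto simp: c_def)
  qed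
  have "c k \<in> {1, 2, 3}" if "k < 71" for k
  proof (cases "k < 37")
    case True
    then show ?thesis using cs123 by (simp add: c_def)
  next
    case False
    then have "k - 37 < 34" using that by linarith
    moreover obtain x y where "neq_pairs \<beta> ! (k - 37) = (x, y)" by fastforce
    ultimately show ?thesis using fresh[of "k - 37" x y] cs123[of x] cs123[of y] False by auto
  qed
  moreover have "c k = std_colours (s (k div 3)) ! (k mod 3)" if "k < 12" for k
  proof -
    have "\<forall>k\<in>set [0, 1, 2, 3, 4, 5, 6, 7, 8, 9, 10, 11 :: nat].
        concat (map std_colours [s 0, s 1, s 2, s 3]) ! k = std_colours (s (k div 3)) ! (k mod 3)"
      by (simp add: std_colours_def)
    moreover have "k \<in> set [0, 1, 2, 3, 4, 5, 6, 7, 8, 9, 10, 11]"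
      using that by (simp only: set_simps insert_iff empty_iff) presburger
    ultimately have "take 12 cs ! k = std_colours (s (k div 3)) ! (k mod 3)"
      unfolding cs(3) by blast
    then show ?thesis using that by (simp add: c_def)
  qed
  moreover have "rainbow c t" if t: "t \<in> set (gadget \<beta>)" for t
  proof (cases "t \<in> set triangles")
    case True
    moreover have "\<forall>(x, y, z)\<in>set triangles. x < 37 \<and> y < 37 \<and> z < 37"
      by (simp add: triangles_def)
    ultimately show ?thesis using cs(4) by (auto simp: rainbow_def c_def)
  next
    case False
    then obtain x y z where xyz: "((x, y), z) \<in> set (zip (neq_pairs \<beta>) [37..<71])" "t = (x, y, z)"
      using t unfolding gadget_def by auto
    then obtain i where i: "i < 34" "neq_pairs \<beta> ! i = (x, y)" "[37..<71] ! i = z"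
      using len unfolding in_set_zip by (metis fst_conv snd_conv)
    have t_eq: "t = (x, y, 37 + i)"
      using xyz(2) i(1,3) by (subst (asm) nth_upt) simp_all
    from fresh[OF i(2,1)] show ?thesis
      using cs123[of x] cs123[of y] unfolding t_eq rainbow_def by auto
  qed
  ultimately show ?thesis by blast
qed

section \<open>The hypergraph of a system\<close>

text \<open>There are \<open>2 * N\<close> variables with 3 vertices and \<open>4 * N\<close>
  gadgets with 59 private ones: 242 = 2 * 3 + 4 * 59. Surplus vertices are isolated.\<close>

locale reduction =
  fixes N n :: nat and h :: "nat \<Rightarrow> nat"
  assumes N_pos: "0 < N" and n_ge: "242 * N \<le> n"
    and h_less: "x < 16 * N \<Longrightarrow> h x < 2 * N"
    and card_fibre: "card {x. x < 16 * N \<and> h x = y} \<le> 16"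
begin

text \<open>
  Variable \<open>y\<close> is the triangle \<open>{3 * y, 3 * y + 1, 3 * y + 2}\<close>. The vertices from
  \<open>6 * N\<close> on are the private vertices of the gadgets, 59 for each.
\<close>

definition emb :: "nat \<Rightarrow> nat \<Rightarrow> nat" where
  "emb i k = (if k < 12 then 3 * h (4 * i + k div 3) + k mod 3 else 6 * N + 59 * i + (k - 12))"

definition gadget_edges :: "nat \<Rightarrow> bool \<Rightarrow> hypergraph" where
  "gadget_edges i \<beta> = (\<lambda>(x, y, z). emb i ` {x, y, z}) ` set (gadget \<beta>)"

definition edges :: "(nat \<Rightarrow> bool) \<Rightarrow> hypergraph" where
  "edges b = (\<Union>i<4 * N. gadget_edges i (b i))"

section \<open>Uniformity and bounded degree\<close>

lemma emb_variable: "i < 4 * N \<Longrightarrow> k < 12 \<Longrightarrow> emb i k < 6 * N"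
proof -
  assume "i < 4 * N" "k < 12"
  then have "k div 3 < 4" by (simp add: less_mult_imp_div_less)
  with \<open>i < 4 * N\<close> have "h (4 * i + k div 3) < 2 * N" by (intro h_less) linarith
  moreover have "k mod 3 < 3" by simp
  ultimately show ?thesis using \<open>k < 12\<close> unfolding emb_def by simp
qed

lemma emb_private:
  assumes "12 \<le> k" "k < 71"
  shows "6 * N \<le> emb i k" "(emb i k - 6 * N) div 59 = i" "(emb i k - 6 * N) mod 59 = k - 12"
    "i < 4 * N \<Longrightarrow> emb i k < 242 * N"
proof -
  obtain l where "k = 12 + l" "l < 59" using assms by (metis le_Suc_ex add_less_cancel_left[of 12 _ 59, simplified])
  then show "6 * N \<le> emb i k" "(emb i k - 6 * N) div 59 = i" "(emb i k - 6 * N) mod 59 = k - 12"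
    "i < 4 * N \<Longrightarrow> emb i k < 242 * N"
    by (simp_all add: emb_def)
qed

lemma emb_less:
  assumes "i < 4 * N" "k < 71"
  shows "emb i k < n"
proof (cases "k < 12")
  case True
  then show ?thesis using emb_variable[OF assms(1) True] n_ge by linarith
next
  case False
  then show ?thesis using emb_private(4)[OF _ assms(2,1)] n_ge by simp
qed

lemma emb_neq:
  assumes "i < 4 * N" "k < 71" "l < 71" "k \<noteq> l" "k < 12 \<Longrightarrow> l < 12 \<Longrightarrow> k div 3 = l div 3"
  shows "emb i k \<noteq> emb i l"
proof (cases "k < 12"; cases "l < 12")
  assume kl: "k < 12" "l < 12"
  then have "k div 3 = l div 3" by (rule assms(5))
  then have "k mod 3 \<noteq> l mod 3" using assms(4) by (metis div_mult_mod_eq)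
  then show ?thesis using kl \<open>k div 3 = l div 3\<close> by (simp add: emb_def)
next
  assume "k < 12" "\<not> l < 12"
  then show ?thesis using emb_variable[of i k] emb_private(1)[of l i] assms by linarith
next
  assume "\<not> k < 12" "l < 12"
  then show ?thesis using emb_variable[of i l] emb_private(1)[of k i] assms by linarith
next
  assume "\<not> k < 12" "\<not> l < 12"
  then show ?thesis using assms(4) by (simp add: emb_def)
qed

lemma gadget_edge_emb:
  assumes "i < 4 * N" "(x, y, z) \<in> set (gadget \<beta>)"
  shows "emb i x \<noteq> emb i y" "emb i y \<noteq> emb i z" "emb i x \<noteq> emb i z"
proof -
  note g = gadget_edge[OF assms(2)]
  show "emb i x \<noteq> emb i y" by (rule emb_neq[OF assms(1)]) (use g(1,2) in blast)+
  show "emb i y \<noteq> emb i z" by (rule emb_neq[OF assms(1)]) (use g(1,3) in blast)+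
  show "emb i x \<noteq> emb i z" by (rule emb_neq[OF assms(1)]) (use g(1,4) in blast)+
qed

lemma in_gadget_edges:
  assumes "e \<in> gadget_edges i \<beta>"
  obtains x y z where "(x, y, z) \<in> set (gadget \<beta>)" "e = {emb i x, emb i y, emb i z}"
    "x < 71" "y < 71" "z < 71"
proof -
  obtain x y z where xyz: "(x, y, z) \<in> set (gadget \<beta>)" "e = emb i ` {x, y, z}"
    using assms unfolding gadget_edges_def by auto
  with gadget_edge(1)[OF xyz(1)] show ?thesis using that[of x y z] by simp
qed

lemma uniform_edges: "uniform_hypergraph 3 n (edges b)"
  unfolding uniform_hypergraph_def
proof
  fix e assume "e \<in> edges b"
  then obtain i where i: "i < 4 * N" "e \<in> gadget_edges i (b i)" by (auto simp: edges_def)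
  from i(2) obtain x y z where xyz: "(x, y, z) \<in> set (gadget (b i))" "e = {emb i x, emb i y, emb i z}"
    "x < 71" "y < 71" "z < 71" by (rule in_gadget_edges)
  then show "e \<subseteq> {..<n} \<and> card e = 3"
    using emb_less[OF i(1)] gadget_edge_emb[OF i(1) xyz(1)] by auto
qed

lemma finite_edges: "finite (edges b)"
  unfolding edges_def gadget_edges_def by simp

lemma card_gadget_edges: "card (gadget_edges i \<beta>) \<le> 46"
  unfolding gadget_edges_def length_gadget[of \<beta>, symmetric]
  by (rule order.trans[OF card_image_le card_length]) simp

text \<open>A variable vertex lies only in gadgets where its variable occurs, a private vertex in at
  most one gadget.\<close>

lemma card_gadgets_at: "card {i. i < 4 * N \<and> v \<in> emb i ` {..<71}} \<le> 16"
proof (cases "v < 6 * N")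
  case True
  let ?F = "{x. x < 16 * N \<and> h x = v div 3}"
  have "{i. i < 4 * N \<and> v \<in> emb i ` {..<71}} \<subseteq> (\<lambda>x. x div 4) ` ?F"
  proof
    fix i assume "i \<in> {i. i < 4 * N \<and> v \<in> emb i ` {..<71}}"
    then obtain k where k: "i < 4 * N" "k < 71" "v = emb i k" by auto
    then have k12: "k < 12" using emb_private(1)[of k i] True by linarith
    then have kd: "k div 3 < 4" by (simp add: less_mult_imp_div_less)
    have "v div 3 = h (4 * i + k div 3)" using k(3) k12 by (simp add: emb_def)
    moreover have "4 * i + k div 3 < 16 * N" using k(1) kd by linarith
    moreover have "i = (4 * i + k div 3) div 4" using kd by simp
    ultimately show "i \<in> (\<lambda>x. x div 4) ` ?F"
      by (intro image_eqI[where x = "4 * i + k div 3"]) simp_all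
  qed
  then have "card {i. i < 4 * N \<and> v \<in> emb i ` {..<71}} \<le> card ?F"
    by (intro surj_card_le) simp_all
  then show ?thesis using card_fibre[of "v div 3"] by (rule order.trans)
next
  case False
  have "{i. i < 4 * N \<and> v \<in> emb i ` {..<71}} \<subseteq> {(v - 6 * N) div 59}"
  proof
    fix i assume "i \<in> {i. i < 4 * N \<and> v \<in> emb i ` {..<71}}"
    then obtain k where k: "i < 4 * N" "k < 71" "v = emb i k" by auto
    then have "12 \<le> k" using emb_variable[of i k] False by linarith
    then show "i \<in> {(v - 6 * N) div 59}" using emb_private(2)[of k i] k by simp
  qed
  from card_mono[OF _ this] show ?thesis by simp
qed

lemma degree_edges: "vertex_degree (edges b) v \<le> 736"
proof -
  let ?I = "{i. i < 4 * N \<and> v \<in> emb i ` {..<71}}"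
  have "{e \<in> edges b. v \<in> e} \<subseteq> (\<Union>i\<in>?I. gadget_edges i (b i))"
  proof
    fix e assume e: "e \<in> {e \<in> edges b. v \<in> e}"
    then obtain i where i: "i < 4 * N" "e \<in> gadget_edges i (b i)" by (auto simp: edges_def)
    from i(2) have "e \<subseteq> emb i ` {..<71}" by (rule in_gadget_edges) auto
    with e i show "e \<in> (\<Union>i\<in>?I. gadget_edges i (b i))" by blast
  qed
  moreover have "finite (\<Union>i\<in>?I. gadget_edges i (b i))" unfolding gadget_edges_def by auto
  ultimately have "vertex_degree (edges b) v \<le> card (\<Union>i\<in>?I. gadget_edges i (b i))"
    unfolding vertex_degree_def by (rule card_mono[rotated])
  also have "\<dots> \<le> (\<Sum>i\<in>?I. card (gadget_edges i (b i)))" by (rule card_UN_le) simp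
  also have "\<dots> \<le> (\<Sum>i\<in>?I. 46)" by (intro sum_mono card_gadget_edges)
  \<comment> \<open>At most 16 gadgets meet at \<open>v\<close>, with at most 46 hyperedges
    each.\<close>
  also have "\<dots> \<le> 16 * 46" using card_gadgets_at[of v] by simp
  finally show ?thesis by simp
qed

lemma bounded_edges: "bounded_3_uniform 736 n (edges b)"
  unfolding bounded_3_uniform_def using uniform_edges degree_edges by blast

text \<open>
  The equation whose right-hand side determines the star of a vertex. The stars of variable
  vertices are the same for all right-hand sides, so the value 0 is arbitrary for them.
\<close>

definition owner :: "nat \<Rightarrow> nat" where
  "owner v = (if 6 * N \<le> v \<and> v < 242 * N then (v - 6 * N) div 59 else 0)"

lemma owner_less: "owner v < 4 * N"
  using N_pos unfolding owner_def by (auto simp: less_mult_imp_div_less)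

lemma owner_emb: "i < 4 * N \<Longrightarrow> 12 \<le> k \<Longrightarrow> k < 71 \<Longrightarrow> owner (emb i k) = i"
  using emb_private[of k i] by (simp add: owner_def)

lemma star_local:
  assumes "b (owner v) = b' (owner v)"
  shows "{e \<in> edges b. v \<in> e} = {e \<in> edges b'. v \<in> e}"
proof -
  have "e \<in> edges b'" if eq: "b (owner v) = b' (owner v)" and e: "e \<in> edges b" "v \<in> e" for b b' e
  proof -
    obtain i where i: "i < 4 * N" "e \<in> gadget_edges i (b i)" using e(1) by (auto simp: edges_def)
    from i(2) obtain x y z where xyz: "(x, y, z) \<in> set (gadget (b i))" "e = {emb i x, emb i y, emb i z}"
      "x < 71" "y < 71" "z < 71" by (rule in_gadget_edges)
    then obtain k where k: "k \<in> {x, y, z}" "v = emb i k" "k < 71" using e(2) by auto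
    have "(x, y, z) \<in> set (gadget (b' i))"
    proof (cases "k < 12")
      case True
      then show ?thesis using gadget_edge_variable[OF xyz(1)] k(1) by blast
    next
      case False
      then have "owner v = i" using owner_emb[OF i(1), of k] k(2,3) by simp
      then show ?thesis using eq xyz(1) by simp
    qed
    then have "e \<in> gadget_edges i (b' i)" unfolding gadget_edges_def xyz(2) by force
    then show ?thesis using i(1) by (auto simp: edges_def)
  qed
  from this[of b b', OF assms] this[of b' b, OF assms[symmetric]] show ?thesis by blast
qed

text \<open>The choice depends only on the set \<open>S\<close>, so equal stars give identical
  lists, including the order; \<open>answer_local\<close> relies on this.\<close>

definition row :: "nat set set \<Rightarrow> nat set option list" where
  "row S = (let es = (SOME es. distinct es \<and> set es = S)
     in map Some es @ replicate (736 - length es) None)"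

definition tab :: "(nat \<Rightarrow> bool) \<Rightarrow> table" where
  "tab b = map (\<lambda>v. row {e \<in> edges b. v \<in> e}) [0..<n]"

lemma represents_tab: "represents 736 n (tab b) (edges b)"
  unfolding represents_def
proof (intro conjI allI impI)
  fix v assume v: "v < n"
  let ?S = "{e \<in> edges b. v \<in> e}"
  let ?es = "SOME es. distinct es \<and> set es = ?S"
  have "\<exists>es. distinct es \<and> set es = ?S"
    using finite_distinct_list[of ?S] finite_edges[of b] by auto
  then have es: "distinct ?es \<and> set ?es = ?S" by (rule someI_ex)
  then have "length ?es \<le> 736"
    using degree_edges[of b v] distinct_card[of ?es] unfolding vertex_degree_def by simp
  then show "\<exists>es. distinct es \<and> set es = ?S \<and> length es \<le> 736 \<and>
      tab b ! v = map Some es @ replicate (736 - length es) None"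
    using es v by (intro exI[of _ ?es]) (simp add: tab_def row_def Let_def)
qed (simp add: tab_def)

lemma length_tab: "length (tab b) = n"
  by (simp add: tab_def)

lemma answer_local:
  assumes "b (owner v) = b' (owner v)"
  shows "answer (tab b) v j = answer (tab b') v j"
proof (cases "v < n")
  case True
  then have "tab b ! v = tab b' ! v"
    using star_local[of b v b', OF assms] by (simp add: tab_def)
  then show ?thesis by (simp add: answer_def length_tab)
qed (simp add: answer_def length_tab)

section \<open>From assignments to colourings and back\<close>

lemma slots_singleton: "slots {i} = {4 * i, 4 * i + 1, 4 * i + 2, 4 * i + 3}"
  unfolding slots_conv_UN by (intro set_eqI, simp, arith)

lemma parity_conv: "parity h X i \<longleftrightarrow>
  (h (4 * i) \<in> X) \<noteq> ((h (4 * i + 1) \<in> X) \<noteq> ((h (4 * i + 2) \<in> X) \<noteq> (h (4 * i + 3) \<in> X)))"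
proof -
  have "{x \<in> slots {i}. h x \<in> X} =
      (if h (4 * i) \<in> X then {4 * i} else {}) \<union> (if h (4 * i + 1) \<in> X then {4 * i + 1} else {}) \<union>
      (if h (4 * i + 2) \<in> X then {4 * i + 2} else {}) \<union> (if h (4 * i + 3) \<in> X then {4 * i + 3} else {})"
    unfolding slots_singleton by auto
  then show ?thesis unfolding parity_def by simp
qed

lemma three_partite_edges:
  assumes X: "\<And>i. i < 4 * N \<Longrightarrow> parity h X i = b i"
  shows "three_partite n (edges b)"
proof -
  have "\<exists>c. (\<forall>k<71. c k \<in> {1, 2, 3}) \<and>
      (\<forall>k<12. c k = std_colours (h (4 * i + k div 3) \<in> X) ! (k mod 3)) \<and>
      (\<forall>t\<in>set (gadget (b i)). rainbow c t)" if "i < 4 * N" for i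
    using gadget_complete[of "\<lambda>a. h (4 * i + a) \<in> X" "b i"] X[OF that] by (simp add: parity_conv)
  then obtain c where c: "\<And>i k. i < 4 * N \<Longrightarrow> k < 71 \<Longrightarrow> c i k \<in> {1, 2, 3}"
    "\<And>i k. i < 4 * N \<Longrightarrow> k < 12 \<Longrightarrow> c i k = std_colours (h (4 * i + k div 3) \<in> X) ! (k mod 3)"
    "\<And>i t. i < 4 * N \<Longrightarrow> t \<in> set (gadget (b i)) \<Longrightarrow> rainbow (c i) t"
    by metis
  \<comment> \<open>The offset inverts \<open>emb\<close> on private vertices. Vertices from
    \<open>242 * N\<close> on are isolated, so 1 is an arbitrary colour.\<close>
  define C where "C v = (if v < 6 * N then std_colours (v div 3 \<in> X) ! (v mod 3)
    else if v < 242 * N then c (owner v) (12 + (v - 6 * N) mod 59) else 1)" for v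
  have C_emb: "C (emb i k) = c i k" if i: "i < 4 * N" and k: "k < 71" for i k
  proof (cases "k < 12")
    case True
    then show ?thesis using emb_variable[OF i True] c(2)[OF i True] by (simp add: C_def emb_def)
  next
    case False
    then have "12 \<le> k" by simp
    from emb_private[OF this k, of i] owner_emb[OF i this k] \<open>12 \<le> k\<close> i show ?thesis
      by (simp add: C_def)
  qed
  have "C v \<in> {1, 2, 3}" for v
  proof (cases "v < 6 * N")
    case True
    have "v mod 3 = 0 \<or> v mod 3 = 1 \<or> v mod 3 = 2" by presburger
    then show ?thesis using True by (auto simp: C_def std_colours_def)
  next
    case False
    have "12 + (v - 6 * N) mod 59 < 71" using mod_less_divisor[of 59 "v - 6 * N"] by linarith
    then show ?thesis using False c(1)[OF owner_less] by (simp add: C_def)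
  qed
  moreover have "inj_on C e" if e: "e \<in> edges b" for e
  proof -
    obtain i where i: "i < 4 * N" "e \<in> gadget_edges i (b i)" using e by (auto simp: edges_def)
    from i(2) obtain x y z where xyz: "(x, y, z) \<in> set (gadget (b i))" "e = {emb i x, emb i y, emb i z}"
      "x < 71" "y < 71" "z < 71" by (rule in_gadget_edges)
    from c(3)[OF i(1) xyz(1)] show ?thesis
      unfolding xyz(2) rainbow_def using C_emb[OF i(1)] xyz(3-5) by (auto simp: inj_on_def)
  qed
  ultimately show ?thesis unfolding three_partite_def by (intro exI[of _ C]) blast
qed

text \<open>A colouring is decoded by the signs of the variable triangles. By
  \<open>gadget_sound\<close>, each violated equation has lost a hyperedge of its gadget, and a
  hyperedge lies in at most 16 gadgets.\<close>

lemma card_violated_le: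
  assumes "three_partite n E'"
  shows "\<exists>X\<in>Pow {..<2 * N}. card {i \<in> {..<4 * N}. parity h X i \<noteq> b i} \<le> 16 * card (edges b - E')"
proof -
  obtain c where c: "c ` {..<n} \<subseteq> {1, 2, 3 :: nat}" "\<And>e. e \<in> E' \<Longrightarrow> inj_on c e"
    using assms unfolding three_partite_def by blast
  define X where "X = {y. y < 2 * N \<and> odd_colours (c (3 * y)) (c (3 * y + 1))}"
  let ?D = "{i \<in> {..<4 * N}. parity h X i \<noteq> b i}"
  have broken: "\<exists>e\<in>gadget_edges i (b i). e \<notin> E'" if i: "i \<in> ?D" for i
  proof (rule ccontr)
    assume "\<not> ?thesis"
    then have inj: "inj_on c e" if "e \<in> gadget_edges i (b i)" for e using c(2) that by blast
    have i4: "i < 4 * N" using i by simp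
    have "rainbow (c \<circ> emb i) t" if "t \<in> set (gadget (b i))" for t
    proof -
      obtain x y z where t: "t = (x, y, z)" by (cases t)
      have "emb i ` {x, y, z} \<in> gadget_edges i (b i)"
        unfolding gadget_edges_def using that t by force
      from inj[OF this] gadget_edge_emb[OF i4, of x y z] show ?thesis
        using that unfolding t rainbow_def by (auto simp: inj_on_def)
    qed
    moreover have "(c \<circ> emb i) k \<in> {1, 2, 3}" if "k < 71" for k
      using c(1) emb_less[OF i4 that] by auto
    ultimately have "(odd_colours (c (emb i 0)) (c (emb i 1)) \<noteq> (odd_colours (c (emb i 3)) (c (emb i 4)) \<noteq>
        (odd_colours (c (emb i 6)) (c (emb i 7)) \<noteq> odd_colours (c (emb i 9)) (c (emb i 10))))) = b i"
      using gadget_sound[of "c \<circ> emb i" "b i"] by simp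
    moreover have "odd_colours (c (emb i (3 * a))) (c (emb i (3 * a + 1))) \<longleftrightarrow> h (4 * i + a) \<in> X"
      if "a < 4" for a
    proof -
      have "h (4 * i + a) < 2 * N" using i4 that by (intro h_less) linarith
      moreover have "emb i (3 * a) = 3 * h (4 * i + a)" "emb i (3 * a + 1) = 3 * h (4 * i + a) + 1"
        using that by (simp_all add: emb_def div_Suc mod_Suc)
      ultimately show ?thesis by (simp add: X_def)
    qed
    from this[of 0] this[of 1] this[of 2] this[of 3]
    have "odd_colours (c (emb i 0)) (c (emb i 1)) = (h (4 * i) \<in> X)"
      "odd_colours (c (emb i 3)) (c (emb i 4)) = (h (4 * i + 1) \<in> X)"
      "odd_colours (c (emb i 6)) (c (emb i 7)) = (h (4 * i + 2) \<in> X)"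
      "odd_colours (c (emb i 9)) (c (emb i 10)) = (h (4 * i + 3) \<in> X)"
      by simp_all
    ultimately have "parity h X i = b i" unfolding parity_conv by simp
    then show False using i by simp
  qed
  have "?D \<subseteq> (\<Union>e\<in>edges b - E'. {i. i < 4 * N \<and> e \<in> gadget_edges i (b i)})"
    using broken by (fastforce simp: edges_def)
  moreover have "finite (\<Union>e\<in>edges b - E'. {i. i < 4 * N \<and> e \<in> gadget_edges i (b i)})"
    using finite_edges by auto
  ultimately have "card ?D \<le> card (\<Union>e\<in>edges b - E'. {i. i < 4 * N \<and> e \<in> gadget_edges i (b i)})"
    by (rule card_mono[rotated])
  also have "\<dots> \<le> (\<Sum>e\<in>edges b - E'. card {i. i < 4 * N \<and> e \<in> gadget_edges i (b i)})"
    using finite_edges by (intro card_UN_le) auto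
  also have "\<dots> \<le> (\<Sum>e\<in>edges b - E'. 16)"
  proof (intro sum_mono)
    fix e assume "e \<in> edges b - E'"
    then have "card e = 3" using uniform_edges[of b] by (auto simp: uniform_hypergraph_def)
    then obtain v where v: "v \<in> e" by fastforce
    have "{i. i < 4 * N \<and> e \<in> gadget_edges i (b i)} \<subseteq> {i. i < 4 * N \<and> v \<in> emb i ` {..<71}}"
    proof
      fix i assume i: "i \<in> {i. i < 4 * N \<and> e \<in> gadget_edges i (b i)}"
      then have "e \<in> gadget_edges i (b i)" by simp
      then have "e \<subseteq> emb i ` {..<71}" by (rule in_gadget_edges) auto
      with v i show "i \<in> {i. i < 4 * N \<and> v \<in> emb i ` {..<71}}" by blast
    qed
    from card_mono[OF _ this] show "card {i. i < 4 * N \<and> e \<in> gadget_edges i (b i)} \<le> 16"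
      using card_gadgets_at[of v] by simp
  qed
  finally have "card ?D \<le> 16 * card (edges b - E')" by simp
  then show ?thesis by (intro bexI[of _ X]) (auto simp: X_def)
qed

text \<open>In the constant, 48 = 3 * 16 combines \<open>far\<close> with
  \<open>card_violated_le\<close>, 484 bounds \<open>n / N\<close>, and 736 normalises the
  distance.\<close>

lemma far_edges:
  assumes far: "\<And>X. X \<in> Pow {..<2 * N} \<Longrightarrow> N < 3 * card {i \<in> {..<4 * N}. parity h X i \<noteq> b i}"
    and n: "n \<le> 484 * N"
  shows "far_from three_partite 736 (1 / (48 * 484 * 736)) n (edges b)"
  unfolding far_from_def
proof (intro allI impI)
  fix E' assume "uniform_hypergraph 3 n E' \<and> three_partite n E'"
  then obtain X where X: "X \<in> Pow {..<2 * N}"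
    "card {i \<in> {..<4 * N}. parity h X i \<noteq> b i} \<le> 16 * card (edges b - E')"
    using card_violated_le by blast
  have "N < 48 * card (edges b - E')" using far[OF X(1)] X(2) by linarith
  then have "n < 484 * 48 * card (edges b - E')" using n by linarith
  then have "real n < real (484 * 48 * card (edges b - E'))" by (simp only: of_nat_less_iff)
  then have less: "real n < 484 * 48 * real (card (edges b - E'))" by simp
  have "0 < n" using N_pos n_ge by simp
  then have "1 / (48 * 484 * 736) < real (card (edges b - E')) / (real 736 * real n)"
    using less by (simp add: field_simps)
  also have "\<dots> \<le> hypergraph_dist 736 n (edges b) E'"
    unfolding hypergraph_dist_def by (intro divide_right_mono) simp_all
  finally show "1 / (48 * 484 * 736) < hypergraph_dist 736 n (edges b) E'" .
qed

end

section \<open>The lower bound\<close>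

lemma sum_accept_prob:
  assumes "finite \<Omega>"
  shows "(\<Sum>w\<in>\<Omega>. accept_prob \<T> (A w)) =
    measure_pmf.expectation \<T> (\<lambda>T. real (card {w \<in> \<Omega>. accepts T (A w)}))"
proof -
  have "(\<Sum>w\<in>\<Omega>. accept_prob \<T> (A w)) =
      (\<Sum>w\<in>\<Omega>. measure_pmf.expectation \<T> (indicator {T. accepts T (A w)}))"
    by (simp add: accept_prob_def)
  also have "\<dots> = measure_pmf.expectation \<T> (\<lambda>T. \<Sum>w\<in>\<Omega>. indicator {T. accepts T (A w)} T)"
    by (rule Bochner_Integration.integral_sum[symmetric])
       (auto intro!: integrable_real_indicator simp: measure_pmf.emeasure_finite less_top[symmetric])
  also have "(\<lambda>T. \<Sum>w\<in>\<Omega>. indicator {T. accepts T (A w)} T :: real) =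
      (\<lambda>T. real (card {w \<in> \<Omega>. accepts T (A w)}))"
    using assms by (simp add: indicator_def sum.If_cases Int_def)
  finally show ?thesis .
qed

context reduction
begin

lemma parity_sym_diff: "parity h (sym_diff X Z) i \<longleftrightarrow> (parity h X i \<noteq> parity h Z i)"
proof -
  have mem: "x \<in> sym_diff X Z \<longleftrightarrow> (x \<in> X) \<noteq> (x \<in> Z)" for x by blast
  show ?thesis unfolding parity_conv mem by argo
qed

text \<open>The equations in \<open>Q\<close> are independent, so their number of solutions is the
  same for all right-hand sides.\<close>

lemma card_parity_shifted:
  assumes indep: "\<And>S. S \<subseteq> {..<4 * N} \<Longrightarrow> S \<noteq> {} \<Longrightarrow> card S \<le> K \<Longrightarrow>
      \<exists>y. odd (card {x \<in> slots S. h x = y})"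
    and Q: "Q \<subseteq> {..<4 * N}" "card Q \<le> K"
  shows "card {X \<in> Pow {..<2 * N}. \<forall>i\<in>Q. parity h X i = g i} =
    card {X \<in> Pow {..<2 * N}. \<forall>i\<in>Q. (parity h X i \<noteq> b i) = g i}"
proof -
  have fin: "finite Q" using Q(1) finite_subset by blast
  have odd: "\<exists>y<2 * N. odd (card {x \<in> slots S. h x = y})" if S: "S \<subseteq> Q" "S \<noteq> {}" for S
  proof -
    have S4: "S \<subseteq> {..<4 * N}" using S(1) Q(1) by blast
    have "card S \<le> K" using card_mono[OF fin S(1)] Q(2) by simp
    then obtain y where y: "odd (card {x \<in> slots S. h x = y})" using indep[OF S4 S(2)] by blast
    then have "{x \<in> slots S. h x = y} \<noteq> {}" by (metis card.empty even_zero)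
    then obtain x where "x \<in> slots S" "h x = y" by blast
    then have "y < 2 * N" using slots_subset[OF S4] h_less[of x] by auto
    with y show ?thesis by blast
  qed
  have "(parity h X i \<noteq> b i) = g i \<longleftrightarrow> parity h X i = (g i \<noteq> b i)" for X i by blast
  then have "card {X \<in> Pow {..<2 * N}. \<forall>i\<in>Q. (parity h X i \<noteq> b i) = g i} * 2 ^ card Q = 2 ^ (2 * N)"
    using card_parity_solutions[OF fin odd, of "\<lambda>i. g i \<noteq> b i"] by simp
  also have "\<dots> = card {X \<in> Pow {..<2 * N}. \<forall>i\<in>Q. parity h X i = g i} * 2 ^ card Q"
    by (rule card_parity_solutions[OF fin odd, symmetric])
  finally show ?thesis by simp
qed

text \<open>Yao's principle: each tree accepts equally many satisfiable and far inputs, so the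
  average acceptance probabilities coincide, yet one is at least 2/3 and the other at most
  1/3.\<close>

lemma no_tester_with_few_queries:
  assumes indep: "\<And>S. S \<subseteq> {..<4 * N} \<Longrightarrow> S \<noteq> {} \<Longrightarrow> card S \<le> K \<Longrightarrow>
      \<exists>y. odd (card {x \<in> slots S. h x = y})"
    and n: "n \<le> 484 * N"
    and tester: "is_tester three_partite 736 (1 / (48 * 484 * 736)) n \<T>"
    and queries: "queries_at_most 736 n \<T> K"
  shows False
proof -
  obtain b where b: "\<forall>X\<in>Pow {..<2 * N}. N < 3 * card {i \<in> {..<4 * N}. parity h X i \<noteq> b i}"
    using ex_far_from_all[OF N_pos, of "parity h"] by blast
  let ?\<Omega> = "Pow {..<2 * N}"
  let ?F = "\<lambda>X i. parity h X i" and ?G = "\<lambda>X i. parity h X i \<noteq> b i"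
  have acc_F: "2 / 3 \<le> accept_prob \<T> (tab (?F X))" for X
    using tester bounded_edges represents_tab three_partite_edges[of X "?F X"]
    unfolding is_tester_def by blast
  have acc_G: "accept_prob \<T> (tab (?G Z)) \<le> 1 / 3" if Z: "Z \<in> ?\<Omega>" for Z
  proof -
    \<comment> \<open>By linearity, translating \<open>b\<close> by the parities of \<open>Z\<close>
      amounts to replacing \<open>X\<close> by \<open>sym_diff X Z\<close>.\<close>
    have "N < 3 * card {i \<in> {..<4 * N}. parity h X i \<noteq> ?G Z i}" if "X \<in> ?\<Omega>" for X
    proof -
      have "sym_diff X Z \<in> ?\<Omega>" using that Z by blast
      moreover have "{i \<in> {..<4 * N}. parity h X i \<noteq> ?G Z i} =
          {i \<in> {..<4 * N}. parity h (sym_diff X Z) i \<noteq> b i}"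
        unfolding parity_sym_diff by blast
      ultimately show ?thesis using b by simp
    qed
    then have "far_from three_partite 736 (1 / (48 * 484 * 736)) n (edges (?G Z))"
      by (rule far_edges[OF _ n])
    then show ?thesis
      using tester bounded_edges represents_tab unfolding is_tester_def by blast
  qed
  have same: "card {X \<in> ?\<Omega>. accepts T (tab (?F X))} = card {X \<in> ?\<Omega>. accepts T (tab (?G X))}"
    if "T \<in> set_pmf \<T>" for T
  proof (rule card_accepts_eq[where q = owner and m = "4 * N" and K = K])
    show "num_queries T (tab b') \<le> K" for b'
      using queries that bounded_edges represents_tab unfolding queries_at_most_def by blast
    show "answer (tab b') v j = answer (tab b'') v j" if "b' (owner v) = b'' (owner v)" for b' b'' v j
      using that by (rule answer_local)
    show "card {X \<in> ?\<Omega>. \<forall>i\<in>Q. ?F X i = g i} = card {X \<in> ?\<Omega>. \<forall>i\<in>Q. ?G X i = g i}"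
      if "Q \<subseteq> {..<4 * N}" "card Q \<le> K" for Q g
      by (rule card_parity_shifted[OF indep that])
  qed (simp_all add: owner_less)
  have "2 / 3 * real (card ?\<Omega>) = (\<Sum>X\<in>?\<Omega>. 2 / 3)" by simp
  also have "\<dots> \<le> (\<Sum>X\<in>?\<Omega>. accept_prob \<T> (tab (?F X)))" by (intro sum_mono acc_F)
  also have "\<dots> = measure_pmf.expectation \<T> (\<lambda>T. real (card {X \<in> ?\<Omega>. accepts T (tab (?F X))}))"
    by (rule sum_accept_prob) simp
  also have "\<dots> = measure_pmf.expectation \<T> (\<lambda>T. real (card {X \<in> ?\<Omega>. accepts T (tab (?G X))}))"
  proof (rule integral_cong_AE)
    show "AE T in measure_pmf \<T>. real (card {X \<in> ?\<Omega>. accepts T (tab (?F X))}) =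
        real (card {X \<in> ?\<Omega>. accepts T (tab (?G X))})"
      unfolding AE_measure_pmf_iff by (intro ballI arg_cong[where f = real] same)
  qed simp_all
  also have "\<dots> = (\<Sum>X\<in>?\<Omega>. accept_prob \<T> (tab (?G X)))"
    by (rule sum_accept_prob[symmetric]) simp
  also have "\<dots> \<le> (\<Sum>X\<in>?\<Omega>. 1 / 3)" by (intro sum_mono acc_G)
  also have "\<dots> = 1 / 3 * real (card ?\<Omega>)" by simp
  finally have "card ?\<Omega> = 0" by simp
  then show False by (simp add: card_Pow)
qed

end

text \<open>Rounding down to a multiple of 242 costs at most a factor of 2.\<close>

lemma le_484_mult_div:
  fixes n :: nat
  assumes "242 \<le> n"
  shows "n \<le> 484 * (n div 242)"
proof -
  have "1 \<le> n div 242" using div_le_mono[OF assms, of 242] by simp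
  moreover have "n mod 242 < 242" by simp
  moreover have "n = 242 * (n div 242) + n mod 242" by simp
  ultimately show ?thesis by linarith
qed

lemma query_complexity_lower_bound:
  assumes "242 \<le> n"
  shows "n div 242 div 1728 < query_complexity three_partite 736 (1 / (48 * 484 * 736)) n"
proof (rule ccontr)
  let ?N = "n div 242" and ?\<epsilon> = "1 / (48 * 484 * 736) :: real"
  let ?S = "{q. \<exists>\<T>. is_tester three_partite 736 ?\<epsilon> n \<T> \<and> queries_at_most 736 n \<T> q}"
  assume "\<not> ?thesis"
  then have le: "Inf ?S \<le> ?N div 1728" unfolding query_complexity_def by simp
  \<comment> \<open>Nonemptiness makes the infimum a minimum, so an optimal tester can be
    chosen.\<close>
  have "?S \<noteq> {}" using tester_exists[of ?\<epsilon> three_partite 736 n] by auto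
  then have "Inf ?S \<in> ?S" by (rule Inf_nat_def1)
  then obtain \<T> where \<T>: "is_tester three_partite 736 ?\<epsilon> n \<T>" "queries_at_most 736 n \<T> (Inf ?S)" by blast
  have queries: "queries_at_most 736 n \<T> (?N div 1728)"
    using \<T>(2) le unfolding queries_at_most_def by (meson order.trans)
  have N: "0 < ?N" "242 * ?N \<le> n" "n \<le> 484 * ?N"
    using assms le_484_mult_div[OF assms] by (auto simp: div_greater_zero_iff)
  obtain h :: "nat \<Rightarrow> nat" where h: "\<forall>x<16 * ?N. h x < 2 * ?N"
    "\<forall>y. card {x. x < 16 * ?N \<and> h x = y} \<le> 16"
    "\<forall>S \<subseteq> {..<4 * ?N}. S \<noteq> {} \<longrightarrow> card S \<le> ?N div 1728 \<longrightarrow>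
      (\<exists>y. odd (card {x \<in> slots S. h x = y}))"
    using ex_independent_system[OF N(1)] by blast
  have red: "reduction ?N n h"
  proof (rule reduction.intro)
    show "h x < 2 * ?N" if "x < 16 * ?N" for x using h(1) that by blast
    show "card {x. x < 16 * ?N \<and> h x = y} \<le> 16" for y using h(2) by (rule spec)
  qed (rule N)+
  show False
    by (rule reduction.no_tester_with_few_queries[OF red _ N(3) \<T>(1) queries])
       (use h(3) in blast)
qed

theorem theorem7:
  "\<exists>(d :: nat) (\<epsilon> :: real). d > 0 \<and> \<epsilon> > 0 \<and>
     (\<lambda>n. real (query_complexity three_partite d \<epsilon> n)) \<in> \<Omega>(\<lambda>n. real n)"
proof (intro exI conjI)
  let ?\<epsilon> = "1 / (48 * 484 * 736) :: real"
  have "\<forall>\<^sub>F n in sequentially. 1 / (484 * 1728) * norm (real n) \<le>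
      norm (real (query_complexity three_partite 736 ?\<epsilon> n))"
    using eventually_ge_at_top[of 242]
  proof eventually_elim
    case (elim n)
    let ?q = "query_complexity three_partite 736 ?\<epsilon> n"
    have "n div 242 < 1728 * ?q"
      using query_complexity_lower_bound[OF elim] by (simp add: div_less_iff_less_mult mult.commute)
    moreover have "n \<le> 484 * (n div 242)" by (rule le_484_mult_div[OF elim])
    ultimately have "n \<le> 484 * 1728 * ?q" by linarith
    then have "real n \<le> real (484 * 1728 * ?q)" by (simp only: of_nat_le_iff)
    then show ?case by simp
  qed
  then show "(\<lambda>n. real (query_complexity three_partite 736 ?\<epsilon> n)) \<in> \<Omega>(\<lambda>n. real n)"
    by (rule landau_omega.bigI[rotated]) simp
qed simp_all

end
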